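(* Assume that for every $p\in D$ the function $f_p:\mathbb R\to\mathbb R$ is continuous, non-decreasing and satisfies $f_p(0)=0$. For $\gamma\in\mathbb R_+^E$ and $k=1,\dots,n$ let $\varphi^{(k)}=\varphi^{(k)}_\gamma\in\mathbb R^{\partial D}$ be the boundary datum with $\varphi^{(k)}|_{J_{k,1}}=\mathbf e_k$, $\varphi^{(k)}|_{J_{k,2}}=\varphi_{k,2}(\mathbf e_k,\gamma)$ and $\varphi^{(k)}=0$ elsewhere on $\partial D$, and let $$M_-(\gamma):=\bigl\{(\varphi^{(k)}_\gamma,\ \psi^{(k)}_\gamma:=F_\gamma(\varphi^{(k)}_\gamma))\bigr\}_{k=1}^n\in(\mathbb R^{\partial D}\times\mathbb R^{\partial D})^n .$$ Then the conductivity on $E(\overline D_{\le n+1})$ is uniquely determined by $M_-(\gamma)$: if $\gamma,\gamma'\in\mathbb R_+^E$ satisfy $M_-(\gamma)=M_-(\gamma')$ (as families indexed by $k$), then $\gamma|_{E(\overline D_{\le n+1})}=\gamma'|_{E(\overline D_{\le n+1})}$. Moreover, if each $f_p$ is of class $C^r$, then for every $\gamma_0\in\mathbb R_+^E$ there exist an open neighborhood $\mathcal U\subset(\mathbb R^{\partial D}\times\mathbb R^{\partial D})^n$ of $M_-(\gamma_0)$ and a $C^r$ map $\mathcal C:\mathcal U\to\mathbb R^{E(\overline D_{\le n+1})}$ such that $\mathcal C(M_-(\gamma))=\gamma|_{E(\overline D_{\le n+1})}$ for every $\gamma\in\mathbb R_+^E$ with $M_-(\gamma)\in\mathcal U$.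
   Context: Square lattice. Fix an integer $n\ge1$. Let $D=\{(i,j): i,j=1,\dots,n\}$ (interior nodes), $\partial D=\{(0,j),(n+1,j),(i,0),(i,n+1): i,j=1,\dots,n\}$ (boundary nodes), $\overline D=D\cup\partial D$. The edge set $E$ consists of the unordered pairs $\{p,q\}$ with $p=(i,j)\in D$, $q=(i',j')\in\overline D$, $|i-i'|+|j-j'|=1$. For $p\in\overline D$, $N(p)=\{q\in\overline D:\{p,q\}\in E\}$. For a finite set $S$, $\mathbb R^S$ is the space of real functions on $S$; $\mathbb R_+=(0,\infty)$. A conductivity is $\gamma\in\mathbb R_+^E$, with $\gamma_{pq}=\gamma_{qp}$ its value on $\{p,q\}$. Direct problem. $f=(f_p)_{p\in D}$ is a fixed known family of functions $\mathbb R\to\mathbb R$. Given $\varphi\in\mathbb R^{\partial D}$, $u\in\mathbb R^{\overline D}$ solves the problem if $\sum_{q\in N(p)}\gamma_{pq}(u_q-u_p)=f_p(u_p)$ for all $p\in D$ and $u_p=\varphi_p$ for all $p\in\partial D$. If each $f_p$ is continuous and non-decreasing there is a unique solution $u_{\gamma,\varphi}$. The nonlinear Dirichlet-to-Neumann map $F_\gamma:\mathbb R^{\partial D}\to\mathbb R^{\partial D}$ is $(F_\gamma(\varphi))_p=\sum_{q\in N(p)}\gamma_{pq}(u_p-u_q)$, $p\in\partial D$, with $u=u_{\gamma,\varphi}$. Layers. For $X\in\{D,\partial D,\overline D\}$: $X_\ell=\{(i,j)\in X:i+j=\ell\}$, $X_{\le\ell}=\{(i,j)\in X:i+j\le\ell\}$,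 $X_{>\ell}=X\setminus X_{\le\ell}$. For a node set $X\subset\overline D$, $E(X)$ is the set of edges in $E$ with both endpoints in $X$. Corner data. $V_{k}=V_{k,\gamma}=\{\varphi\in\mathbb R^{\partial D}:\varphi|_{\partial D_{>k}}=0,\ F_\gamma(\varphi)|_{\partial D_{>k}}=0\}$. $J_{k,1}=\{(i,j)\in\partial D_{\le k}: j=0\}$ and $J_{k,2}=\{(i,j)\in\partial D_{\le k}: i=0\}$. When each $f_p$ is continuous, non-decreasing with $f_p(0)=0$, for $1\le k\le n$ and $\varphi_{k,1}\in\mathbb R^{J_{k,1}}$ there is a unique $\varphi_{k,2}=\varphi_{k,2}(\varphi_{k,1},\gamma)\in\mathbb R^{J_{k,2}}$ such that the boundary datum equal to $\varphi_{k,1}$ on $J_{k,1}$, $\varphi_{k,2}$ on $J_{k,2}$ and $0$ elsewhere belongs to $V_{k,\gamma}$. $\mathbf e_k\in\mathbb R^{J_{k,1}}$ is the coordinate vector equal to $1$ at the node $(k,0)$ and $0$ at the other nodes of $J_{k,1}$. *)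

theory Defs
  imports "HOL-Analysis.Analysis" "HOL-Library.Extended_Nat"
begin

type_synonym node = "nat \<times> nat"
type_synonym edge = "node set"

text \<open>
  For a finite set \<open>S\<close> the space of real functions on \<open>S\<close> is represented by the functions that are
  \<open>undefined\<close> outside \<open>S\<close>, so that HOL equality is equality on \<open>S\<close>. It is the carrier of
  \<open>powertop_real S\<close>.
\<close>

abbreviation funs :: "'a set \<Rightarrow> ('a \<Rightarrow> real) set"
  where "funs S \<equiv> S \<rightarrow>\<^sub>E UNIV"


subsection \<open>The square lattice\<close>

definition interior_nodes :: "nat \<Rightarrow> node set"
  where "interior_nodes n = {1..n} \<times> {1..n}"

definition boundary_nodes :: "nat \<Rightarrow> node set"
  where "boundary_nodes n =
    (\<Union>i\<in>{1..n}. {(0, i), (n + 1, i), (i, 0), (i, n + 1)})"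

definition nodes :: "nat \<Rightarrow> node set"
  where "nodes n = interior_nodes n \<union> boundary_nodes n"

definition edges :: "nat \<Rightarrow> edge set"
  where "edges n = {{(i, j), (i', j')} | i j i' j'.
    (i, j) \<in> interior_nodes n \<and> (i', j') \<in> nodes n \<and>
    \<bar>int i - int i'\<bar> + \<bar>int j - int j'\<bar> = 1}"

definition nbrs :: "nat \<Rightarrow> node \<Rightarrow> node set"
  where "nbrs n p = {q \<in> nodes n. {p, q} \<in> edges n}"

definition layers_upto :: "node set \<Rightarrow> nat \<Rightarrow> node set"
  where "layers_upto X l = {(i, j) \<in> X. i + j \<le> l}"

definition layers_above :: "node set \<Rightarrow> nat \<Rightarrow> node set"
  where "layers_above X l = X - layers_upto X l"

definition edges_within :: "nat \<Rightarrow> node set \<Rightarrow> edge set"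
  where "edges_within n X = {e \<in> edges n. e \<subseteq> X}"

definition corner_edges :: "nat \<Rightarrow> edge set"
  where "corner_edges n = edges_within n (layers_upto (nodes n) (n + 1))"

definition conductivities :: "nat \<Rightarrow> (edge \<Rightarrow> real) set"
  where "conductivities n = edges n \<rightarrow>\<^sub>E {0<..}"


subsection \<open>The Dirichlet problem and the Dirichlet-to-Neumann map\<close>

definition solves_dirichlet ::
  "nat \<Rightarrow> (node \<Rightarrow> real \<Rightarrow> real) \<Rightarrow> (edge \<Rightarrow> real) \<Rightarrow> (node \<Rightarrow> real) \<Rightarrow> (node \<Rightarrow> real) \<Rightarrow> bool"
  where "solves_dirichlet n f \<gamma> \<phi> u \<longleftrightarrow>
    u \<in> funs (nodes n) \<and>
    (\<forall>p\<in>interior_nodes n. (\<Sum>q\<in>nbrs n p. \<gamma> {p, q} * (u q - u p)) = f p (u p)) \<and>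
    (\<forall>p\<in>boundary_nodes n. u p = \<phi> p)"

text \<open>
  The two definite descriptions below denote the intended objects when each \<open>f p\<close> is continuous
  and non-decreasing (for the first one) and moreover vanishes at \<open>0\<close> (for the second one).
\<close>

definition dirichlet_solution ::
  "nat \<Rightarrow> (node \<Rightarrow> real \<Rightarrow> real) \<Rightarrow> (edge \<Rightarrow> real) \<Rightarrow> (node \<Rightarrow> real) \<Rightarrow> (node \<Rightarrow> real)"
  where "dirichlet_solution n f \<gamma> \<phi> = (THE u. solves_dirichlet n f \<gamma> \<phi> u)"

definition DN_map ::
  "nat \<Rightarrow> (node \<Rightarrow> real \<Rightarrow> real) \<Rightarrow> (edge \<Rightarrow> real) \<Rightarrow> (node \<Rightarrow> real) \<Rightarrow> (node \<Rightarrow> real)"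
  where "DN_map n f \<gamma> \<phi> =
    (let u = dirichlet_solution n f \<gamma> \<phi>
     in (\<lambda>p\<in>boundary_nodes n. \<Sum>q\<in>nbrs n p. \<gamma> {p, q} * (u p - u q)))"


subsection \<open>Corner data\<close>

definition corner_space ::
  "nat \<Rightarrow> (node \<Rightarrow> real \<Rightarrow> real) \<Rightarrow> (edge \<Rightarrow> real) \<Rightarrow> nat \<Rightarrow> (node \<Rightarrow> real) set"
  where "corner_space n f \<gamma> k = {\<phi> \<in> funs (boundary_nodes n).
    \<forall>p\<in>layers_above (boundary_nodes n) k. \<phi> p = 0 \<and> DN_map n f \<gamma> \<phi> p = 0}"

definition J1 :: "nat \<Rightarrow> nat \<Rightarrow> node set"
  where "J1 n k = {(i, j) \<in> layers_upto (boundary_nodes n) k. j = 0}"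

definition J2 :: "nat \<Rightarrow> nat \<Rightarrow> node set"
  where "J2 n k = {(i, j) \<in> layers_upto (boundary_nodes n) k. i = 0}"

definition glue :: "nat \<Rightarrow> nat \<Rightarrow> (node \<Rightarrow> real) \<Rightarrow> (node \<Rightarrow> real) \<Rightarrow> (node \<Rightarrow> real)"
  where "glue n k a b =
    (\<lambda>p\<in>boundary_nodes n. if p \<in> J1 n k then a p else if p \<in> J2 n k then b p else 0)"

definition phi2 ::
  "nat \<Rightarrow> (node \<Rightarrow> real \<Rightarrow> real) \<Rightarrow> (edge \<Rightarrow> real) \<Rightarrow> nat \<Rightarrow> (node \<Rightarrow> real) \<Rightarrow> (node \<Rightarrow> real)"
  where "phi2 n f \<gamma> k a = (THE b. b \<in> funs (J2 n k) \<and> glue n k a b \<in> corner_space n f \<gamma> k)"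

definition unit_vec :: "nat \<Rightarrow> nat \<Rightarrow> (node \<Rightarrow> real)"
  where "unit_vec n k = (\<lambda>p\<in>J1 n k. if p = (k, 0) then 1 else 0)"

definition corner_datum ::
  "nat \<Rightarrow> (node \<Rightarrow> real \<Rightarrow> real) \<Rightarrow> (edge \<Rightarrow> real) \<Rightarrow> nat \<Rightarrow> (node \<Rightarrow> real)"
  where "corner_datum n f \<gamma> k = glue n k (unit_vec n k) (phi2 n f \<gamma> k (unit_vec n k))"

text \<open>
  The space of \<open>n\<close>-tuples of pairs of real functions on the boundary is written in coordinates, as
  the space of real functions on \<open>meas_index n\<close>: the coordinate \<open>(k, Inl p)\<close> is the value at \<open>p\<close>
  of the first component of the \<open>k\<close>-th pair, and \<open>(k, Inr p)\<close> that of the second component.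
\<close>

definition meas_index :: "nat \<Rightarrow> (nat \<times> (node + node)) set"
  where "meas_index n = {1..n} \<times> (boundary_nodes n <+> boundary_nodes n)"

definition M_minus ::
  "nat \<Rightarrow> (node \<Rightarrow> real \<Rightarrow> real) \<Rightarrow> (edge \<Rightarrow> real) \<Rightarrow> (nat \<times> (node + node) \<Rightarrow> real)"
  where "M_minus n f \<gamma> = (\<lambda>(k, s)\<in>meas_index n.
    case s of Inl p \<Rightarrow> corner_datum n f \<gamma> k p
            | Inr p \<Rightarrow> DN_map n f \<gamma> (corner_datum n f \<gamma> k) p)"


subsection \<open>Functions of class \<open>C\<^sup>r\<close>, with \<open>r\<close> finite or infinite\<close>

definition C_class_real :: "enat \<Rightarrow> (real \<Rightarrow> real) \<Rightarrow> bool"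
  where "C_class_real r g \<longleftrightarrow>
    (\<forall>m. enat m \<le> r \<longrightarrow> continuous_on UNIV ((deriv ^^ m) g)) \<and>
    (\<forall>m. enat m < r \<longrightarrow> (\<forall>x. (deriv ^^ m) g differentiable (at x)))"

definition partial_deriv :: "'i \<Rightarrow> (('i \<Rightarrow> real) \<Rightarrow> real) \<Rightarrow> (('i \<Rightarrow> real) \<Rightarrow> real)"
  where "partial_deriv i G x = deriv (\<lambda>t. G (x(i := t))) (x i)"

text \<open>
  \<open>G\<close> has continuous iterated partial derivatives of all orders up to \<open>r\<close> on \<open>U\<close>; meant for a
  finite index set \<open>I\<close> and a set \<open>U\<close> that is open in \<open>powertop_real I\<close>, in which case only the
  values of \<open>G\<close> on \<open>U\<close> matter.
\<close>

definition C_class_on :: "enat \<Rightarrow> 'i set \<Rightarrow> ('i \<Rightarrow> real) set \<Rightarrow> (('i \<Rightarrow> real) \<Rightarrow> real) \<Rightarrow> bool"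
  where "C_class_on r I U G \<longleftrightarrow>
    (\<forall>is. set is \<subseteq> I \<and> enat (length is) \<le> r \<longrightarrow>
      continuous_map (subtopology (powertop_real I) U) euclideanreal (foldr partial_deriv is G)) \<and>
    (\<forall>is. set is \<subseteq> I \<and> enat (length is) < r \<longrightarrow>
      (\<forall>x\<in>U. \<forall>i\<in>I. (\<lambda>t. foldr partial_deriv is G (x(i := t))) differentiable (at (x i))))"

end

theory Submission
  imports Defs
begin

text \<open>
  The data \<open>corner_datum n f \<gamma> k\<close> drive a state that vanishes above layer \<open>k\<close> and, by the balance
  of the two currents entering each node of layer \<open>k + 1\<close>, vanishes nowhere on layer \<open>k\<close>. Suppose
  the conductivities below layer \<open>k\<close> are known. Marching inwards from the measured Cauchy data on
  the side \<open>j = 0\<close> gives the state up to layer \<open>k\<close>, and the equations on the layers \<open>k\<close> and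
  \<open>k + 1\<close> then give the edges between these layers one after the other, dividing only by known
  nonzero values of the state. So each conductivity is obtained from the data by finitely many
  arithmetic operations and applications of the \<open>f p\<close>, which preserve class \<open>C\<^sup>r\<close>. The case
  \<open>r = 0\<close> already gives global uniqueness, because conductivities with the same data share a
  local inverse.
\<close>

subsection \<open>Functions of class \<open>C\<^sup>r\<close>\<close>

text \<open>Moving one coordinate is a continuous map from the line into the product space, so
  openness of \<open>U\<close> pulls back. Hence partial derivatives at points of \<open>U\<close>
  depend only on values on \<open>U\<close>.\<close>

lemma eventually_fun_upd_in:
  assumes "openin (powertop_real I) U" "x \<in> U" "i \<in> I"
  shows "\<forall>\<^sub>F t in nhds (x i). x(i := t) \<in> U"
proof -
  have x: "x \<in> funs I"
    using openin_subset[OF assms(1)] assms(2) by auto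
  have "continuous_map euclideanreal (powertop_real I) (\<lambda>t. x(i := t))"
    unfolding continuous_map_componentwise_UNIV
  proof (subst continuous_map_componentwise, intro conjI ballI)
    show "(\<lambda>t. x(i := t)) ` topspace euclideanreal \<subseteq> extensional I"
      using x assms(3) by (auto simp: extensional_def PiE_def)
    show "continuous_map euclideanreal euclideanreal (\<lambda>t. (x(i := t)) k)" for k
      by (cases "k = i") auto
  qed
  then have "openin euclideanreal {t \<in> topspace euclideanreal. x(i := t) \<in> U}"
    using assms(1) by (rule openin_continuous_map_preimage)
  then have "open {t. x(i := t) \<in> U}"
    by simp
  from eventually_nhds_in_open[OF this, of "x i"] show ?thesis
    using assms(2) by simp
qed

text \<open>A recursive counterpart of \<open>C_class_on\<close> at finite order. Differentiating
  once lowers \<open>m\<close> by one, which permits induction on \<open>m\<close> with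
  \<open>G\<close> varying.\<close>

fun Ck :: "nat \<Rightarrow> 'i set \<Rightarrow> ('i \<Rightarrow> real) set \<Rightarrow> (('i \<Rightarrow> real) \<Rightarrow> real) \<Rightarrow> bool"
  where
    "Ck 0 I U G \<longleftrightarrow> continuous_map (subtopology (powertop_real I) U) euclideanreal G"
  | "Ck (Suc m) I U G \<longleftrightarrow> continuous_map (subtopology (powertop_real I) U) euclideanreal G \<and>
      (\<forall>x\<in>U. \<forall>i\<in>I. (\<lambda>t. G (x(i := t))) differentiable (at (x i))) \<and>
      (\<forall>i\<in>I. Ck m I U (partial_deriv i G))"

text \<open>\<open>foldr partial_deriv is G\<close> applies the last index of \<open>is\<close>
  first, so detaching the last entry isolates the innermost derivative.\<close>

lemma list_snoc_all:
  "(\<forall>is. set is \<subseteq> I \<and> length is \<le> Suc m \<longrightarrow> P is) \<longleftrightarrow>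
    P [] \<and> (\<forall>i\<in>I. \<forall>is. set is \<subseteq> I \<and> length is \<le> m \<longrightarrow> P (is @ [i]))"
proof (intro iffI conjI allI impI ballI)
  fix "is" :: "'a list"
  assume P: "P [] \<and> (\<forall>i\<in>I. \<forall>is. set is \<subseteq> I \<and> length is \<le> m \<longrightarrow> P (is @ [i]))"
    and "is": "set is \<subseteq> I \<and> length is \<le> Suc m"
  show "P is"
    using P "is" by (cases "is" rule: rev_cases) auto
qed auto

lemma C_class_on_Suc:
  "C_class_on (enat (Suc m)) I U G \<longleftrightarrow>
    continuous_map (subtopology (powertop_real I) U) euclideanreal G \<and>
    (\<forall>x\<in>U. \<forall>i\<in>I. (\<lambda>t. G (x(i := t))) differentiable (at (x i))) \<and>
    (\<forall>i\<in>I. C_class_on (enat m) I U (partial_deriv i G))"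
\<comment> \<open>The bound \<open>length is < m\<close> has the form required by
  \<open>list_snoc_all\<close> or its tail only for positive \<open>m\<close>; for
  \<open>m = 0\<close> the conditions concern only the empty and one-element lists.\<close>
proof (cases m)
  case 0
  have le0: "(\<forall>is. set is \<subseteq> I \<and> enat (length is) \<le> enat 0 \<longrightarrow> Q is) \<longleftrightarrow> Q []"
    and less1: "(\<forall>is. set is \<subseteq> I \<and> enat (length is) < enat (Suc 0) \<longrightarrow> Q is) \<longleftrightarrow> Q []"
    and le1: "(\<forall>is. set is \<subseteq> I \<and> enat (length is) \<le> enat (Suc 0) \<longrightarrow> Q is) \<longleftrightarrow>
      Q [] \<and> (\<forall>i\<in>I. Q [i])" for Q
    using list_snoc_all[of I 0 Q] by (auto simp: enat_0_iff)
  show ?thesis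
    unfolding C_class_on_def 0 le0 less1 le1 by auto
next
  case (Suc l)
  have "enat (length is) < enat (Suc m) \<longleftrightarrow> length is \<le> Suc l"
    "enat (length is) < enat m \<longleftrightarrow> length is \<le> l" for "is" :: "'a list"
    using Suc by auto
  then show ?thesis
    unfolding C_class_on_def enat_ord_simps list_snoc_all by (simp add: list_snoc_all) blast
qed

lemma C_class_on_enat: "C_class_on (enat m) I U G \<longleftrightarrow> Ck m I U G"
proof (induction m arbitrary: G)
  case 0
  then show ?case by (auto simp: C_class_on_def enat_0_iff)
next
  case (Suc m)
  then show ?case by (simp add: C_class_on_Suc)
qed

text \<open>Each list of indices involves a finite order, so infinite \<open>r\<close> is covered as
  well. Differentiability along a list shorter than \<open>r\<close> is read off at order
  \<open>Suc (length is)\<close>, which is still at most \<open>r\<close>.\<close>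

lemma C_class_on_iff_Ck: "C_class_on r I U G \<longleftrightarrow> (\<forall>m. enat m \<le> r \<longrightarrow> Ck m I U G)"
proof
  assume "C_class_on r I U G"
  then have "C_class_on (enat m) I U G" if "enat m \<le> r" for m
    using that unfolding C_class_on_def by (meson order.trans order.strict_trans2)
  then show "\<forall>m. enat m \<le> r \<longrightarrow> Ck m I U G"
    by (simp add: C_class_on_enat)
next
  assume "\<forall>m. enat m \<le> r \<longrightarrow> Ck m I U G"
  then have C: "C_class_on (enat m) I U G" if "enat m \<le> r" for m
    using that by (simp add: C_class_on_enat)
  show "C_class_on r I U G"
    unfolding C_class_on_def
  proof (intro conjI allI impI)
    fix "is" :: "'a list"
    assume a: "set is \<subseteq> I \<and> enat (length is) \<le> r"
    with C[of "length is"]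
    show "continuous_map (subtopology (powertop_real I) U) euclideanreal (foldr partial_deriv is G)"
      unfolding C_class_on_def by simp
  next
    fix "is" :: "'a list"
    assume a: "set is \<subseteq> I \<and> enat (length is) < r"
    then have "enat (Suc (length is)) \<le> r"
      by (simp add: Suc_ile_eq)
    from C[OF this] a
    show "\<forall>x\<in>U. \<forall>i\<in>I. (\<lambda>t. foldr partial_deriv is G (x(i := t))) differentiable (at (x i))"
      unfolding C_class_on_def by simp
  qed
qed

lemma Ck_SucD: "Ck (Suc m) I U G \<Longrightarrow> Ck m I U G"
proof (induction m arbitrary: G)
  case 0
  then show ?case by simp
next
  case (Suc m)
  from Suc.prems have "Ck m I U (partial_deriv i G)" if "i \<in> I" for i
    using that Suc.IH by (metis Ck.simps(2))
  with Suc.prems show ?case by simp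
qed

lemma Ck_subset:
  assumes "V \<subseteq> U"
  shows "Ck m I U G \<Longrightarrow> Ck m I V G"
proof (induction m arbitrary: G)
  case 0
  then show ?case
    using assms by (auto intro: continuous_map_from_subtopology_mono)
next
  case (Suc m)
  then show ?case
    using assms by (auto intro: continuous_map_from_subtopology_mono)
qed

lemma Ck_has_partial:
  assumes "Ck (Suc m) I U G" "x \<in> U" "i \<in> I"
  shows "((\<lambda>t. G (x(i := t))) has_field_derivative partial_deriv i G x) (at (x i))"
  using assms by (simp add: partial_deriv_def DERIV_deriv_iff_real_differentiable)

lemma partial_deriv_eq:
  assumes "((\<lambda>t. G (x(i := t))) has_field_derivative D) (at (x i))"
  shows "partial_deriv i G x = D"
  using assms unfolding partial_deriv_def by (rule DERIV_imp_deriv)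

text \<open>A derivative sees only nearby points, and near \<open>x i\<close> the coordinate line
  stays inside the open set \<open>U\<close>, where \<open>G\<close> and \<open>H\<close>
  agree.\<close>

lemma has_partial_cong:
  assumes U: "openin (powertop_real I) U" and eq: "\<And>x. x \<in> U \<Longrightarrow> G x = H x"
    and "x \<in> U" "i \<in> I"
  shows "((\<lambda>t. G (x(i := t))) has_field_derivative D) (at (x i)) \<longleftrightarrow>
    ((\<lambda>t. H (x(i := t))) has_field_derivative D) (at (x i))"
proof (rule DERIV_cong_ev[OF refl _ refl])
  show "\<forall>\<^sub>F t in nhds (x i). G (x(i := t)) = H (x(i := t))"
    using eventually_fun_upd_in[OF U assms(3,4)] by eventually_elim (simp add: eq)
qed

lemma Ck_cong:
  assumes U: "openin (powertop_real I) U"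
  shows "(\<And>x. x \<in> U \<Longrightarrow> G x = H x) \<Longrightarrow> Ck m I U G \<Longrightarrow> Ck m I U H"
proof (induction m arbitrary: G H)
  case 0
  then show ?case by (auto elim: continuous_map_eq)
next
  case (Suc m)
  have der: "((\<lambda>t. H (x(i := t))) has_field_derivative partial_deriv i G x) (at (x i))"
    if "x \<in> U" "i \<in> I" for x i
    using Ck_has_partial[OF Suc.prems(2) that] has_partial_cong[OF U Suc.prems(1) that, of "\<lambda>x. x"]
    by blast
  have "Ck m I U (partial_deriv i H)" if "i \<in> I" for i
  proof (rule Suc.IH)
    show "Ck m I U (partial_deriv i G)" using Suc.prems(2) that by simp
    show "partial_deriv i G x = partial_deriv i H x" if "x \<in> U" for x
      using partial_deriv_eq[OF der[OF that \<open>i \<in> I\<close>]] by simp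
  qed
  moreover have "continuous_map (subtopology (powertop_real I) U) euclideanreal H"
    using Suc.prems by (auto elim: continuous_map_eq)
  ultimately show ?case
    using der by (auto simp: real_differentiable_def)
qed

section \<open>Closure under arithmetic and composition\<close>

text \<open>Explicit formulas \<open>D i\<close> can replace \<open>partial_deriv i G\<close>: the
  two agree on \<open>U\<close>, and \<open>Ck_cong\<close> transfers the class. The closure proofs
  supply the usual differentiation rules as \<open>D\<close>.\<close>

lemma Ck_SucI:
  assumes U: "openin (powertop_real I) U"
    and "continuous_map (subtopology (powertop_real I) U) euclideanreal G"
    and der: "\<And>i x. i \<in> I \<Longrightarrow> x \<in> U \<Longrightarrow>
      ((\<lambda>t. G (x(i := t))) has_field_derivative D i x) (at (x i))"
    and "\<And>i. i \<in> I \<Longrightarrow> Ck m I U (D i)"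
  shows "Ck (Suc m) I U G"
proof -
  have "Ck m I U (partial_deriv i G)" if "i \<in> I" for i
    by (rule Ck_cong[OF U _ assms(4)[OF that]]) (simp add: partial_deriv_eq[OF der] that)
  with assms(2) der show ?thesis
    by (auto simp: real_differentiable_def)
qed

lemma Ck_const: "openin (powertop_real I) U \<Longrightarrow> Ck m I U (\<lambda>x. c)"
proof (induction m arbitrary: c)
  case (Suc m)
  then show ?case by (intro Ck_SucI[where D = "\<lambda>i x. 0"]) auto
qed auto

lemma Ck_proj:
  assumes U: "openin (powertop_real I) U" and "j \<in> I"
  shows "Ck m I U (\<lambda>x. x j)"
proof -
  have *: "continuous_map (subtopology (powertop_real I) U) euclideanreal (\<lambda>x. x j)"
    using assms(2) by (intro continuous_map_from_subtopology continuous_map_product_projection)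
  show ?thesis
  proof (cases m)
    case 0
    with * show ?thesis by simp
  next
    case (Suc l)
    show ?thesis
      unfolding Suc using U *
      by (rule Ck_SucI[where D = "\<lambda>i x. if i = j then 1 else 0"]) (auto intro: Ck_const U)
  qed
qed

lemma Ck_add:
  assumes U: "openin (powertop_real I) U"
  shows "Ck m I U G \<Longrightarrow> Ck m I U H \<Longrightarrow> Ck m I U (\<lambda>x. G x + H x)"
proof (induction m arbitrary: G H)
  case 0
  then show ?case by (simp add: continuous_map_add)
next
  case (Suc m)
  show ?case
  proof (rule Ck_SucI[OF U, where D = "\<lambda>i x. partial_deriv i G x + partial_deriv i H x"])
    show "((\<lambda>t. G (x(i := t)) + H (x(i := t))) has_field_derivative
        partial_deriv i G x + partial_deriv i H x) (at (x i))" if "i \<in> I" "x \<in> U" for i x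
      using Suc.prems that by (intro DERIV_add Ck_has_partial)
  qed (use Suc in \<open>auto intro: continuous_map_add\<close>)
qed

lemma Ck_mult:
  assumes U: "openin (powertop_real I) U"
  shows "Ck m I U G \<Longrightarrow> Ck m I U H \<Longrightarrow> Ck m I U (\<lambda>x. G x * H x)"
proof (induction m arbitrary: G H)
  case 0
  then show ?case by (simp add: continuous_map_real_mult)
next
  case (Suc m)
  show ?case
  proof (rule Ck_SucI[OF U, where D = "\<lambda>i x. partial_deriv i G x * H x + partial_deriv i H x * G x"])
    show "((\<lambda>t. G (x(i := t)) * H (x(i := t))) has_field_derivative
        partial_deriv i G x * H x + partial_deriv i H x * G x) (at (x i))"
      if "i \<in> I" "x \<in> U" for i x
      by (rule DERIV_cong[OF DERIV_mult[OF Ck_has_partial[OF Suc.prems(1) that(2,1)]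
            Ck_has_partial[OF Suc.prems(2) that(2,1)]]]) simp
    show "Ck m I U (\<lambda>x. partial_deriv i G x * H x + partial_deriv i H x * G x)" if "i \<in> I" for i
      using Suc.prems that Ck_SucD[OF Suc.prems(1)] Ck_SucD[OF Suc.prems(2)]
      by (intro Ck_add Suc.IH U) auto
  qed (use Suc.prems in \<open>auto intro: continuous_map_real_mult\<close>)
qed

lemma Ck_inverse:
  assumes U: "openin (powertop_real I) U" and nz: "\<And>x. x \<in> U \<Longrightarrow> G x \<noteq> 0"
  shows "Ck m I U G \<Longrightarrow> Ck m I U (\<lambda>x. inverse (G x))"
proof (induction m)
  case 0
  then show ?case using nz by (auto intro: continuous_map_real_inverse)
next
  case (Suc m)
  note C = Ck_SucD[OF Suc.prems]
  show ?case
  \<comment> \<open>The derivative \<open>- G' / G^2\<close> is written as a product with factors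
    \<open>inverse (G x)\<close>, so that the induction hypothesis and closure under products give
    order \<open>m\<close>.\<close>
  proof (rule Ck_SucI[OF U, where D = "\<lambda>i x. (-1) * (inverse (G x) * partial_deriv i G x * inverse (G x))"])
    show "((\<lambda>t. inverse (G (x(i := t)))) has_field_derivative
        (-1) * (inverse (G x) * partial_deriv i G x * inverse (G x))) (at (x i))"
      if "i \<in> I" "x \<in> U" for i x
      by (rule DERIV_cong[OF DERIV_inverse'[OF Ck_has_partial[OF Suc.prems that(2,1)]]])
        (use nz[OF that(2)] in simp_all)
    show "Ck m I U (\<lambda>x. (-1) * (inverse (G x) * partial_deriv i G x * inverse (G x)))"
      if "i \<in> I" for i
      using Suc.prems that Suc.IH[OF C] by (intro Ck_mult Ck_const U) auto
  qed (use Suc.prems nz in \<open>auto intro: continuous_map_real_inverse\<close>)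
qed

lemma C_class_real_Suc:
  assumes "C_class_real (enat (Suc m)) g"
  shows "C_class_real (enat m) (deriv g)" "(g has_field_derivative deriv g t) (at t)"
proof -
  have c: "continuous_on UNIV ((deriv ^^ l) g)" if "l \<le> Suc m" for l
    using assms that unfolding C_class_real_def by simp
  have d: "(deriv ^^ l) g differentiable (at x)" if "l < Suc m" for l x
    using assms that unfolding C_class_real_def by simp
  have "(deriv ^^ l) (deriv g) = (deriv ^^ Suc l) g" for l
    by (simp add: funpow_swap1)
  then show "C_class_real (enat m) (deriv g)"
    unfolding C_class_real_def using c[of "Suc l" for l] d[of "Suc l" for l] by auto
  show "(g has_field_derivative deriv g t) (at t)"
    using d[of 0 t] by (simp add: DERIV_deriv_iff_real_differentiable)
qed

lemma C_class_real_continuous: "C_class_real r g \<Longrightarrow> continuous_on UNIV g"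
  unfolding C_class_real_def by (auto dest: spec[of _ 0] simp: enat_0)

text \<open>The induction varies \<open>g\<close> because the chain rule replaces it by
  \<open>deriv g\<close>, which has one order less; \<open>G\<close> stays the same and merely drops
  to order \<open>m\<close>.\<close>

lemma Ck_compose:
  assumes U: "openin (powertop_real I) U"
  shows "C_class_real (enat m) g \<Longrightarrow> Ck m I U G \<Longrightarrow> Ck m I U (\<lambda>x. g (G x))"
proof (induction m arbitrary: g)
  case 0
  from continuous_map_compose[of _ euclideanreal G euclideanreal g] 0 show ?case
    by (simp add: C_class_real_continuous o_def)
next
  case (Suc m)
  note C = Ck_SucD[OF Suc.prems(2)]
  show ?case
  proof (rule Ck_SucI[OF U, where D = "\<lambda>i x. deriv g (G x) * partial_deriv i G x"])
    show "continuous_map (subtopology (powertop_real I) U) euclideanreal (\<lambda>x. g (G x))"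
      using continuous_map_compose[of _ euclideanreal G euclideanreal g] Suc.prems
      by (simp add: C_class_real_continuous o_def)
    show "((\<lambda>t. g (G (x(i := t)))) has_field_derivative
        deriv g (G x) * partial_deriv i G x) (at (x i))"
      if "i \<in> I" "x \<in> U" for i x
      by (rule DERIV_chain2[OF _ Ck_has_partial[OF Suc.prems(2) that(2,1)]])
        (simp add: C_class_real_Suc(2)[OF Suc.prems(1)])
    show "Ck m I U (\<lambda>x. deriv g (G x) * partial_deriv i G x)" if "i \<in> I" for i
      using Suc.prems(2) that Suc.IH[OF C_class_real_Suc(1)[OF Suc.prems(1)] C]
      by (intro Ck_mult U) auto
  qed
qed

section \<open>Transfer to finite or infinite \<open>r\<close>\<close>

lemma C_class_on_const: "openin (powertop_real I) U \<Longrightarrow> C_class_on r I U (\<lambda>x. c)"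
  by (simp add: C_class_on_iff_Ck Ck_const)

lemma C_class_on_proj: "openin (powertop_real I) U \<Longrightarrow> j \<in> I \<Longrightarrow> C_class_on r I U (\<lambda>x. x j)"
  by (simp add: C_class_on_iff_Ck Ck_proj)

lemma C_class_on_add:
  "openin (powertop_real I) U \<Longrightarrow> C_class_on r I U G \<Longrightarrow> C_class_on r I U H \<Longrightarrow>
    C_class_on r I U (\<lambda>x. G x + H x)"
  by (simp add: C_class_on_iff_Ck Ck_add)

lemma C_class_on_mult:
  "openin (powertop_real I) U \<Longrightarrow> C_class_on r I U G \<Longrightarrow> C_class_on r I U H \<Longrightarrow>
    C_class_on r I U (\<lambda>x. G x * H x)"
  by (simp add: C_class_on_iff_Ck Ck_mult)

lemma C_class_on_inverse:
  "openin (powertop_real I) U \<Longrightarrow> (\<And>x. x \<in> U \<Longrightarrow> G x \<noteq> 0) \<Longrightarrow> C_class_on r I U G \<Longrightarrow>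
    C_class_on r I U (\<lambda>x. inverse (G x))"
  by (simp add: C_class_on_iff_Ck Ck_inverse)

lemma C_class_real_mono: "C_class_real r g \<Longrightarrow> enat m \<le> r \<Longrightarrow> C_class_real (enat m) g"
  unfolding C_class_real_def by (meson order.trans order.strict_trans2)

lemma C_class_on_compose:
  "openin (powertop_real I) U \<Longrightarrow> C_class_real r g \<Longrightarrow> C_class_on r I U G \<Longrightarrow>
    C_class_on r I U (\<lambda>x. g (G x))"
  by (simp add: C_class_on_iff_Ck Ck_compose C_class_real_mono)

lemma C_class_on_subset: "C_class_on r I U G \<Longrightarrow> V \<subseteq> U \<Longrightarrow> C_class_on r I V G"
  by (auto simp: C_class_on_iff_Ck intro: Ck_subset)

lemma C_class_on_continuous:
  "C_class_on r I U G \<Longrightarrow> continuous_map (subtopology (powertop_real I) U) euclideanreal G"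
  by (auto simp: C_class_on_iff_Ck zero_enat_def[symmetric] dest: spec[of _ 0])

lemma open_funs: "openin (powertop_real I) (funs I)"
  using openin_topspace[of "powertop_real I"] by simp

subsection \<open>The lattice and the Dirichlet problem\<close>

lemma interior_nodes_iff: "(i, j) \<in> interior_nodes n \<longleftrightarrow> 1 \<le> i \<and> i \<le> n \<and> 1 \<le> j \<and> j \<le> n"
  by (auto simp: interior_nodes_def)

lemma boundary_nodes_iff:
  "(i, j) \<in> boundary_nodes n \<longleftrightarrow>
    1 \<le> i \<and> i \<le> n \<and> (j = 0 \<or> j = n + 1) \<or> 1 \<le> j \<and> j \<le> n \<and> (i = 0 \<or> i = n + 1)"
  by (auto simp: boundary_nodes_def)

lemma nodes_iff:
  "(i, j) \<in> nodes n \<longleftrightarrow> 1 \<le> i \<and> i \<le> n \<and> j \<le> n + 1 \<or> 1 \<le> j \<and> j \<le> n \<and> i \<le> n + 1"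
  unfolding nodes_def Un_iff interior_nodes_iff boundary_nodes_iff by linarith

lemma finite_interior_nodes [simp]: "finite (interior_nodes n)"
  by (simp add: interior_nodes_def)

lemma finite_boundary_nodes [simp]: "finite (boundary_nodes n)"
  by (simp add: boundary_nodes_def)

lemma finite_nodes [simp]: "finite (nodes n)"
  by (simp add: nodes_def)

lemma boundary_not_interior: "p \<in> boundary_nodes n \<Longrightarrow> p \<notin> interior_nodes n"
  by (cases p) (auto simp: boundary_nodes_iff interior_nodes_iff)

definition adjacent :: "node \<Rightarrow> node \<Rightarrow> bool"
  where "adjacent p q \<longleftrightarrow> \<bar>int (fst p) - int (fst q)\<bar> + \<bar>int (snd p) - int (snd q)\<bar> = 1"

lemma adjacent_commute: "adjacent p q \<longleftrightarrow> adjacent q p"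
  by (simp add: adjacent_def abs_minus_commute)

lemma adjacent_iff:
  "adjacent (i, j) (a, b) \<longleftrightarrow>
    a = i \<and> (b = Suc j \<or> j = Suc b) \<or> b = j \<and> (a = Suc i \<or> i = Suc a)"
  unfolding adjacent_def fst_conv snd_conv by (smt (verit) of_nat_Suc of_nat_eq_iff)

lemma edge_iff:
  "{p, q} \<in> edges n \<longleftrightarrow> adjacent p q \<and>
    (p \<in> interior_nodes n \<and> q \<in> nodes n \<or> q \<in> interior_nodes n \<and> p \<in> nodes n)"
proof -
  have "edges n = {{p, q} | p q. p \<in> interior_nodes n \<and> q \<in> nodes n \<and> adjacent p q}"
    unfolding edges_def adjacent_def by simp
  also have "{p, q} \<in> \<dots> \<longleftrightarrow> (\<exists>a b. {p, q} = {a, b} \<and> a \<in> interior_nodes n \<and> b \<in> nodes n \<and> adjacent a b)"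
    by blast
  finally show ?thesis
    unfolding doubleton_eq_iff using adjacent_commute by metis
qed

lemma finite_edges [simp]: "finite (edges n)"
proof (rule finite_subset)
  show "edges n \<subseteq> Pow (nodes n)"
    by (auto simp: edges_def nodes_def)
qed simp

lemma nbrs_iff:
  "q \<in> nbrs n p \<longleftrightarrow> adjacent p q \<and>
    (p \<in> interior_nodes n \<and> q \<in> nodes n \<or> q \<in> interior_nodes n \<and> p \<in> nodes n)"
  unfolding nbrs_def edge_iff by (auto simp: nodes_def)

lemma nbrs_interior:
  assumes "Suc i \<le> n" "Suc j \<le> n"
  shows "nbrs n (Suc i, Suc j) =
    {(i, Suc j), (Suc (Suc i), Suc j), (Suc i, j), (Suc i, Suc (Suc j))}" (is "_ = ?S")
proof -
  have "(Suc i, Suc j) \<in> interior_nodes n" "(Suc i, Suc j) \<in> nodes n"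
    using assms by (simp_all add: interior_nodes_iff nodes_iff)
  then have "nbrs n (Suc i, Suc j) = {q. adjacent (Suc i, Suc j) q} \<inter> nodes n"
    by (auto simp: nbrs_iff nodes_def)
  also have "{q. adjacent (Suc i, Suc j) q} = ?S"
    by (auto simp: adjacent_iff)
  also have "?S \<inter> nodes n = ?S"
    using assms by (simp add: nodes_iff)
  finally show ?thesis .
qed

text \<open>An edge needs an interior endpoint, so a boundary node is joined only to the node
  directly inside it; neighbouring boundary nodes are not joined.\<close>

lemma nbrs_boundary:
  assumes "1 \<le> i" "i \<le> n"
  shows "nbrs n (i, 0) = {(i, 1)}" "nbrs n (0, i) = {(1, i)}"
    "nbrs n (Suc n, i) = {(n, i)}" "nbrs n (i, Suc n) = {(i, n)}"
proof -
  have *: "nbrs n p = {q. adjacent p q} \<inter> interior_nodes n" if "p \<in> boundary_nodes n" for p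
    using that boundary_not_interior[OF that] by (auto simp: nbrs_iff nodes_def)
  have b: "(i, 0) \<in> boundary_nodes n" "(0, i) \<in> boundary_nodes n"
    "(Suc n, i) \<in> boundary_nodes n" "(i, Suc n) \<in> boundary_nodes n"
    using assms by (auto simp: boundary_nodes_iff)
  show "nbrs n (i, 0) = {(i, 1)}" "nbrs n (0, i) = {(1, i)}"
    "nbrs n (Suc n, i) = {(n, i)}" "nbrs n (i, Suc n) = {(i, n)}"
    unfolding *[OF b(1)] *[OF b(2)] *[OF b(3)] *[OF b(4)]
    using assms by (auto simp: adjacent_iff interior_nodes_iff)
qed

lemma finite_nbrs [simp]: "finite (nbrs n p)"
  by (simp add: nbrs_def)

lemma nbrs_in_nodes: "q \<in> nbrs n p \<Longrightarrow> q \<in> nodes n"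
  by (simp add: nbrs_def)

lemma nbrs_interior_nonempty: "p \<in> interior_nodes n \<Longrightarrow> nbrs n p \<noteq> {}"
proof (cases p)
  case (Pair i j)
  moreover assume "p \<in> interior_nodes n"
  ultimately obtain i' j' where "i = Suc i'" "j = Suc j'" "Suc i' \<le> n" "Suc j' \<le> n"
    by (cases i; cases j) (auto simp: interior_nodes_iff)
  then show ?thesis
    using Pair by (simp add: nbrs_interior)
qed

lemma conductivity_pos: "\<gamma> \<in> conductivities n \<Longrightarrow> e \<in> edges n \<Longrightarrow> \<gamma> e > 0"
  by (auto simp: conductivities_def dest: PiE_mem)

lemma nbrs_conductivity_pos: "\<gamma> \<in> conductivities n \<Longrightarrow> q \<in> nbrs n p \<Longrightarrow> \<gamma> {p, q} > 0"
  by (auto simp: nbrs_def intro: conductivity_pos)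

abbreviation flux :: "nat \<Rightarrow> (edge \<Rightarrow> real) \<Rightarrow> (node \<Rightarrow> real) \<Rightarrow> node \<Rightarrow> real \<Rightarrow> real"
  where "flux n \<gamma> w p t \<equiv> \<Sum>q\<in>nbrs n p. \<gamma> {p, q} * (w q - t)"

section \<open>Comparison, existence and uniqueness for the Dirichlet problem\<close>

locale network =
  fixes n :: nat and f :: "node \<Rightarrow> real \<Rightarrow> real"
  assumes f_cont: "\<And>p. p \<in> interior_nodes n \<Longrightarrow> continuous_on UNIV (f p)"
    and f_mono: "\<And>p. p \<in> interior_nodes n \<Longrightarrow> mono (f p)"
    and f_zero: "\<And>p. p \<in> interior_nodes n \<Longrightarrow> f p 0 = 0"
begin

text \<open>If \<open>t > t'\<close>, then each term of the flux for \<open>w\<close> at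
  \<open>t\<close> is strictly below the one for \<open>w'\<close> at \<open>t'\<close>.
  Monotonicity of \<open>f p\<close> demands the opposite order of the fluxes.\<close>

lemma local_comparison:
  assumes \<gamma>: "\<gamma> \<in> conductivities n" and p: "p \<in> interior_nodes n"
    and w: "\<And>q. q \<in> nodes n \<Longrightarrow> w q \<le> w' q"
    and sub: "flux n \<gamma> w p t \<ge> f p t"
    and super: "flux n \<gamma> w' p t' \<le> f p t'"
  shows "t \<le> t'"
proof (rule ccontr)
  assume "\<not> t \<le> t'"
  then have "flux n \<gamma> w p t < flux n \<gamma> w' p t'"
  proof (intro sum_strict_mono)
    show "\<gamma> {p, q} * (w q - t) < \<gamma> {p, q} * (w' q - t')" if "q \<in> nbrs n p" for q
    proof (rule mult_strict_left_mono)
      show "w q - t < w' q - t'"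
        using w[OF nbrs_in_nodes[OF that]] \<open>\<not> t \<le> t'\<close> by simp
    qed (use \<gamma> that in \<open>rule nbrs_conductivity_pos\<close>)
  qed (use p in \<open>auto dest: nbrs_interior_nonempty\<close>)
  moreover have "f p t' \<le> f p t"
    using \<open>\<not> t \<le> t'\<close> by (intro monoD[OF f_mono[OF p]]) simp
  ultimately show False
    using sub super by linarith
qed

text \<open>The flux is \<open>s - c * t\<close> with \<open>c > 0\<close>, so the task is to solve
  \<open>f p t + c * t = s\<close>. At \<open>0\<close> the left side vanishes, and at
  \<open>s / c\<close> it has passed \<open>s\<close> because \<open>f p\<close> has the sign of its
  argument; the intermediate value theorem applies.\<close>

lemma local_solution:
  assumes \<gamma>: "\<gamma> \<in> conductivities n" and p: "p \<in> interior_nodes n"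
  shows "\<exists>t. flux n \<gamma> w p t = f p t"
proof -
  define c where "c = (\<Sum>q\<in>nbrs n p. \<gamma> {p, q})"
  define s where "s = (\<Sum>q\<in>nbrs n p. \<gamma> {p, q} * w q)"
  have c: "c > 0"
    unfolding c_def using \<gamma> p
    by (intro sum_pos finite_nbrs nbrs_interior_nonempty nbrs_conductivity_pos)
  have flux: "flux n \<gamma> w p t = s - c * t" for t
    by (simp add: c_def s_def sum_distrib_right sum_subtractf right_diff_distrib)
  define h where "h = (\<lambda>t. f p t + c * t)"
  have hc: "continuous_on A h" for A
    unfolding h_def by (intro continuous_intros continuous_on_subset[OF f_cont[OF p]]) auto
  have "\<exists>t. h t = s"
  proof (cases "s \<ge> 0")
    case True
    then have "f p 0 \<le> f p (s / c)"
      using c by (intro monoD[OF f_mono[OF p]]) simp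
    then have "\<exists>t. 0 \<le> t \<and> t \<le> s / c \<and> h t = s"
      using True c by (intro IVT' hc) (auto simp: h_def f_zero[OF p])
    then show ?thesis by blast
  next
    case False
    then have "f p (s / c) \<le> f p 0"
      using c by (intro monoD[OF f_mono[OF p]]) (simp add: divide_nonpos_pos)
    then have "\<exists>t. s / c \<le> t \<and> t \<le> 0 \<and> h t = s"
      using False c by (intro IVT' hc) (auto simp: h_def f_zero[OF p] divide_nonpos_pos)
    then show ?thesis by blast
  qed
  then obtain t where "h t = s" by blast
  then have "flux n \<gamma> w p t = f p t"
    unfolding flux h_def by simp
  then show ?thesis by blast
qed

text \<open>
  Existence by monotone iteration: \<open>T\<close> solves the scalar equation at every interior node with the
  neighbouring values frozen, and its iterates decrease from the supersolution \<open>B\<close> while staying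
  above the subsolution \<open>- B\<close>.
\<close>

lemma dirichlet_exists:
  assumes \<gamma>: "\<gamma> \<in> conductivities n"
  shows "\<exists>u. solves_dirichlet n f \<gamma> \<phi> u"
proof -
  \<comment> \<open>\<open>B\<close> bounds the boundary values in modulus. Since
    \<open>f p B \<ge> 0 \<ge> f p (- B)\<close>, the constants \<open>B\<close> and
    \<open>- B\<close> are a supersolution and a subsolution.\<close>
  define B where "B = (\<Sum>p\<in>boundary_nodes n. \<bar>\<phi> p\<bar>)"
  have B: "\<bar>\<phi> p\<bar> \<le> B" if "p \<in> boundary_nodes n" for p
    unfolding B_def using that by (intro member_le_sum) auto
  have B0: "B \<ge> 0"
    unfolding B_def by (intro sum_nonneg) auto
  define t where "t w p = (SOME t. flux n \<gamma> w p t = f p t)" for w p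
  have t: "flux n \<gamma> w p (t w p) = f p (t w p)" if "p \<in> interior_nodes n" for w p
    unfolding t_def using local_solution[OF \<gamma> that] by (rule someI_ex)
  define T where "T w p = (if p \<in> interior_nodes n then t w p else \<phi> p)" for w p
  define v where "v m = (T ^^ m) (\<lambda>_. B)" for m
  have v_Suc: "v (Suc m) = T (v m)" for m
    by (simp add: v_def)
  have node: "p \<in> interior_nodes n \<or> p \<in> boundary_nodes n" if "p \<in> nodes n" for p
    using that by (auto simp: nodes_def)
  have T_mono: "T w p \<le> T w' p" if "\<And>q. q \<in> nodes n \<Longrightarrow> w q \<le> w' q"
    for w w' :: "node \<Rightarrow> real" and p
  proof (cases "p \<in> interior_nodes n")
    case True
    then show ?thesis
      using local_comparison[OF \<gamma> True, of w w' "t w p" "t w' p"] that t[OF True]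
      by (simp add: T_def)
  qed (simp add: T_def)
  have decr: "v (Suc m) p \<le> v m p" if "p \<in> nodes n" for m p
    using that
  proof (induction m arbitrary: p)
    case 0
    have "t (\<lambda>_. B) p \<le> B" if p: "p \<in> interior_nodes n"
    proof (rule local_comparison[OF \<gamma> p, of "\<lambda>_. B" "\<lambda>_. B"])
      show "flux n \<gamma> (\<lambda>_. B) p B \<le> f p B"
        using monoD[OF f_mono[OF p] B0] by (simp add: f_zero[OF p])
    qed (simp_all add: t p)
    then show ?case
      using node[OF 0] B[of p] by (auto simp: v_def T_def)
  next
    case (Suc m)
    show ?case unfolding v_Suc by (intro T_mono) (use Suc.IH v_Suc in auto)
  qed
  have lower: "- B \<le> v m p" if "p \<in> nodes n" for m p
    using that
  proof (induction m arbitrary: p)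
    case 0
    then show ?case using B0 by (simp add: v_def)
  next
    case (Suc m)
    have "- B \<le> t (v m) p" if p: "p \<in> interior_nodes n"
    proof (rule local_comparison[OF \<gamma> p, of "\<lambda>_. - B" "v m"])
      show "flux n \<gamma> (\<lambda>_. - B) p (- B) \<ge> f p (- B)"
        using monoD[OF f_mono[OF p], of "- B" 0] B0 by (simp add: f_zero[OF p])
    qed (simp_all add: t p Suc.IH)
    then show ?case
      unfolding v_Suc using node[OF Suc.prems] B[of p] by (auto simp: T_def)
  qed
  define l where "l p = lim (\<lambda>m. v m p)" for p
  have l: "(\<lambda>m. v m p) \<longlonglongrightarrow> l p" if p: "p \<in> nodes n" for p
  proof -
    have "decseq (\<lambda>m. v m p)"
      using decr[OF p] by (rule decseq_SucI)
    then have "convergent (\<lambda>m. v m p)"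
      using lower[OF p] by (metis decseq_convergent convergentI)
    then show ?thesis
      unfolding l_def by (simp add: convergent_LIMSEQ_iff)
  qed
  define u where "u = restrict l (nodes n)"
  have int_node: "p \<in> nodes n" if "p \<in> interior_nodes n" for p
    using that by (simp add: nodes_def)
  have "solves_dirichlet n f \<gamma> \<phi> u"
    unfolding solves_dirichlet_def
  proof (intro conjI ballI)
    show "u \<in> funs (nodes n)" by (simp add: u_def)
  next
    fix p assume p: "p \<in> interior_nodes n"
    have lim: "(\<lambda>m. v (Suc m) p) \<longlonglongrightarrow> l p"
      using l[OF int_node[OF p]] by (rule LIMSEQ_Suc)
    have "(\<lambda>m. f p (v (Suc m) p)) \<longlonglongrightarrow> f p (l p)"
      using f_cont[OF p] lim by (auto intro: continuous_on_tendsto_compose)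
    moreover have "(\<lambda>m. flux n \<gamma> (v m) p (v (Suc m) p)) \<longlonglongrightarrow> flux n \<gamma> l p (l p)"
      by (intro tendsto_intros lim l nbrs_in_nodes)
    moreover have "flux n \<gamma> (v m) p (v (Suc m) p) = f p (v (Suc m) p)" for m
      by (simp add: v_Suc T_def p t)
    ultimately have "flux n \<gamma> l p (l p) = f p (l p)"
      using LIMSEQ_unique by fastforce
    moreover have "flux n \<gamma> u p (u p) = flux n \<gamma> l p (l p)"
      by (intro sum.cong) (simp_all add: u_def int_node p nbrs_in_nodes)
    ultimately show "flux n \<gamma> u p (u p) = f p (u p)"
      by (simp add: u_def int_node p)
  next
    fix p assume p: "p \<in> boundary_nodes n"
    have "v (Suc m) p = \<phi> p" for m
      using boundary_not_interior[OF p] by (simp add: v_Suc T_def)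
    moreover have "(\<lambda>m. v (Suc m) p) \<longlonglongrightarrow> l p"
      by (rule LIMSEQ_Suc) (use p in \<open>simp add: l nodes_def\<close>)
    ultimately have "l p = \<phi> p"
      by (simp add: LIMSEQ_const_iff)
    with p show "u p = \<phi> p"
      by (simp add: u_def nodes_def)
  qed
  then show ?thesis
    by blast
qed

text \<open>
  If \<open>u - v\<close> had a positive maximum, the maximizer with the largest first index would be interior,
  and the two equations would force the value \<open>m\<close> on its neighbour in the next row as well.
\<close>

lemma dirichlet_le:
  assumes \<gamma>: "\<gamma> \<in> conductivities n"
    and u: "solves_dirichlet n f \<gamma> \<phi> u" and v: "solves_dirichlet n f \<gamma> \<phi> v"
    and p: "p \<in> nodes n"
  shows "u p \<le> v p"
proof (rule ccontr)
  assume neg: "\<not> u p \<le> v p"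
  define d where "d q = u q - v q" for q
  define m where "m = Max (d ` nodes n)"
  have m: "d q \<le> m" if "q \<in> nodes n" for q
    unfolding m_def using that by (intro Max_ge) auto
  have "m > 0"
    using m[OF p] neg by (simp add: d_def)
  define S where "S = {q \<in> nodes n. d q = m}"
  have "m \<in> d ` nodes n"
    unfolding m_def using p by (intro Max_in) auto
  then have "S \<noteq> {}" by (auto simp: S_def)
  have "finite S" by (simp add: S_def)
  define i where "i = Max (fst ` S)"
  have "i \<in> fst ` S"
    unfolding i_def using \<open>S \<noteq> {}\<close> \<open>finite S\<close> by (intro Max_in) auto
  then obtain j where ij: "(i, j) \<in> S" by auto
  have bd: "d q = 0" if "q \<in> boundary_nodes n" for q
    using that u v by (simp add: d_def solves_dirichlet_def)
  have int: "(i, j) \<in> interior_nodes n"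
    using ij bd[of "(i, j)"] \<open>m > 0\<close> by (auto simp: S_def nodes_def)
  then obtain i' j' where i': "i = Suc i'" "j = Suc j'" "Suc i' \<le> n" "Suc j' \<le> n"
    by (cases i; cases j) (auto simp: interior_nodes_iff)
  have "v (i, j) \<le> u (i, j)"
    using ij \<open>m > 0\<close> by (auto simp: S_def d_def)
  then have "f (i, j) (u (i, j)) - f (i, j) (v (i, j)) \<ge> 0"
    by (simp add: monoD[OF f_mono[OF int]])
  \<comment> \<open>As \<open>m\<close> is the value of \<open>d\<close> at \<open>(i, j)\<close>,
    the sum is minus the flux of \<open>d\<close>, which the difference of the two equations
    evaluates.\<close>
  moreover have "(\<Sum>q\<in>nbrs n (i, j). \<gamma> {(i, j), q} * (m - d q)) =
      - (f (i, j) (u (i, j)) - f (i, j) (v (i, j)))"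
  proof -
    have "m = u (i, j) - v (i, j)"
      using ij by (simp add: S_def d_def)
    then have "(\<Sum>q\<in>nbrs n (i, j). \<gamma> {(i, j), q} * (m - d q)) =
        flux n \<gamma> v (i, j) (v (i, j)) - flux n \<gamma> u (i, j) (u (i, j))"
      by (simp add: sum_subtractf[symmetric] d_def right_diff_distrib[symmetric])
        (simp add: algebra_simps)
    then show ?thesis
      using u v int by (simp add: solves_dirichlet_def)
  qed
  ultimately have le: "(\<Sum>q\<in>nbrs n (i, j). \<gamma> {(i, j), q} * (m - d q)) \<le> 0"
    by linarith
  have nonneg: "\<gamma> {(i, j), q} * (m - d q) \<ge> 0" if "q \<in> nbrs n (i, j)" for q
    using nbrs_conductivity_pos[OF \<gamma> that] m[OF nbrs_in_nodes[OF that]] by simp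
  let ?q = "(Suc i, j)"
  have q: "?q \<in> nbrs n (i, j)"
    using i' by (simp add: nbrs_interior)
  have "\<gamma> {(i, j), ?q} * (m - d ?q) = 0"
  proof -
    have "(\<Sum>q\<in>nbrs n (i, j). \<gamma> {(i, j), q} * (m - d q)) = 0"
      using le nonneg by (intro order.antisym sum_nonneg) auto
    then show ?thesis
      using sum_nonneg_eq_0_iff[of "nbrs n (i, j)" "\<lambda>q. \<gamma> {(i, j), q} * (m - d q)"] nonneg q
      by simp
  qed
  then have "d ?q = m"
    using nbrs_conductivity_pos[OF \<gamma> q] by simp
  then have "?q \<in> S"
    using nbrs_in_nodes[OF q] by (simp add: S_def)
  then have "Suc i \<le> i"
    unfolding i_def using \<open>finite S\<close> by (intro Max_ge) force+
  then show False by simp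
qed

lemma dirichlet_solution_eq:
  assumes "\<gamma> \<in> conductivities n" "solves_dirichlet n f \<gamma> \<phi> u"
  shows "dirichlet_solution n f \<gamma> \<phi> = u"
  unfolding dirichlet_solution_def
proof (rule the_equality)
  fix v assume v: "solves_dirichlet n f \<gamma> \<phi> v"
  show "v = u"
  proof (rule extensionalityI)
    show "v \<in> extensional (nodes n)" "u \<in> extensional (nodes n)"
      using v assms(2) by (auto simp: solves_dirichlet_def PiE_def)
    show "v p = u p" if "p \<in> nodes n" for p
      using dirichlet_le[OF assms(1) v assms(2) that] dirichlet_le[OF assms(1) assms(2) v that]
      by simp
  qed
qed (rule assms(2))

end

subsection \<open>States supported in a corner\<close>

text \<open>An edge is named by its endpoint with the smaller coordinate sum, so
  \<open>hedge i j\<close> and \<open>vedge i j\<close> both join layer \<open>i + j\<close> to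
  layer \<open>i + j + 1\<close>.\<close>

definition hedge :: "nat \<Rightarrow> nat \<Rightarrow> edge"
  where "hedge i j = {(i, j), (Suc i, j)}"

definition vedge :: "nat \<Rightarrow> nat \<Rightarrow> edge"
  where "vedge i j = {(i, j), (i, Suc j)}"

text \<open>The flux at \<open>(Suc i, Suc j)\<close>; the shift by one expresses all four
  neighbours without subtraction.\<close>

definition star_sum :: "(edge \<Rightarrow> real) \<Rightarrow> (node \<Rightarrow> real) \<Rightarrow> nat \<Rightarrow> nat \<Rightarrow> real"
  where "star_sum \<gamma> u i j =
    \<gamma> (hedge i (Suc j)) * (u (i, Suc j) - u (Suc i, Suc j)) +
    \<gamma> (hedge (Suc i) (Suc j)) * (u (Suc (Suc i), Suc j) - u (Suc i, Suc j)) +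
    \<gamma> (vedge (Suc i) j) * (u (Suc i, j) - u (Suc i, Suc j)) +
    \<gamma> (vedge (Suc i) (Suc j)) * (u (Suc i, Suc (Suc j)) - u (Suc i, Suc j))"

lemma sum_nbrs_interior:
  assumes "Suc i \<le> n" "Suc j \<le> n"
  shows "(\<Sum>q\<in>nbrs n (Suc i, Suc j). \<gamma> {(Suc i, Suc j), q} * (u q - u (Suc i, Suc j))) =
    star_sum \<gamma> u i j"
  unfolding nbrs_interior[OF assms] star_sum_def hedge_def vedge_def
  by (simp add: insert_commute)

lemma hedge_in_edges: "i \<le> n \<Longrightarrow> 1 \<le> j \<Longrightarrow> j \<le> n \<Longrightarrow> hedge i j \<in> edges n"
  unfolding hedge_def edge_iff adjacent_iff interior_nodes_iff nodes_iff by auto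

lemma vedge_in_edges: "1 \<le> i \<Longrightarrow> i \<le> n \<Longrightarrow> j \<le> n \<Longrightarrow> vedge i j \<in> edges n"
  unfolding vedge_def edge_iff adjacent_iff interior_nodes_iff nodes_iff by auto

lemma hedge_pos:
  "\<gamma> \<in> conductivities n \<Longrightarrow> i \<le> n \<Longrightarrow> 1 \<le> j \<Longrightarrow> j \<le> n \<Longrightarrow> \<gamma> (hedge i j) > 0"
  by (intro conductivity_pos hedge_in_edges)

lemma vedge_pos:
  "\<gamma> \<in> conductivities n \<Longrightarrow> 1 \<le> i \<Longrightarrow> i \<le> n \<Longrightarrow> j \<le> n \<Longrightarrow> \<gamma> (vedge i j) > 0"
  by (intro conductivity_pos vedge_in_edges)

lemma solves_dirichlet_star:
  assumes "solves_dirichlet n f \<gamma> \<phi> u" "Suc i \<le> n" "Suc j \<le> n"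
  shows "star_sum \<gamma> u i j = f (Suc i, Suc j) (u (Suc i, Suc j))"
  using assms unfolding solves_dirichlet_def sum_nbrs_interior[OF assms(2,3), symmetric]
  by (simp add: interior_nodes_iff)

lemma solves_dirichletI:
  assumes "u \<in> funs (nodes n)"
    and "\<And>i j. Suc i \<le> n \<Longrightarrow> Suc j \<le> n \<Longrightarrow> star_sum \<gamma> u i j = f (Suc i, Suc j) (u (Suc i, Suc j))"
    and "\<And>p. p \<in> boundary_nodes n \<Longrightarrow> u p = \<phi> p"
  shows "solves_dirichlet n f \<gamma> \<phi> u"
  unfolding solves_dirichlet_def
proof (intro conjI ballI)
  fix p assume "p \<in> interior_nodes n"
  then obtain i j where p: "p = (Suc i, Suc j)" "Suc i \<le> n" "Suc j \<le> n"
    by (cases p, cases "fst p"; cases "snd p") (auto simp: interior_nodes_iff)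
  show "(\<Sum>q\<in>nbrs n p. \<gamma> {p, q} * (u q - u p)) = f p (u p)"
    unfolding p sum_nbrs_interior[OF p(2,3)] by (rule assms(2)[OF p(2,3)])
qed (use assms in auto)

section \<open>Boundary currents and unique continuation\<close>

context network
begin

lemma DN_map_eq:
  assumes "\<gamma> \<in> conductivities n" "solves_dirichlet n f \<gamma> \<phi> u"
  shows "DN_map n f \<gamma> \<phi> = (\<lambda>p\<in>boundary_nodes n. \<Sum>q\<in>nbrs n p. \<gamma> {p, q} * (u p - u q))"
  unfolding DN_map_def dirichlet_solution_eq[OF assms] Let_def ..

lemma DN_map_sides:
  assumes "\<gamma> \<in> conductivities n" "solves_dirichlet n f \<gamma> \<phi> u" "1 \<le> i" "i \<le> n"
  shows "DN_map n f \<gamma> \<phi> (i, 0) = \<gamma> (vedge i 0) * (u (i, 0) - u (i, 1))"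
    and "DN_map n f \<gamma> \<phi> (0, i) = \<gamma> (hedge 0 i) * (u (0, i) - u (1, i))"
    and "DN_map n f \<gamma> \<phi> (Suc n, i) = \<gamma> (hedge n i) * (u (Suc n, i) - u (n, i))"
    and "DN_map n f \<gamma> \<phi> (i, Suc n) = \<gamma> (vedge i n) * (u (i, Suc n) - u (i, n))"
  using assms(3,4)
  by (simp_all add: DN_map_eq[OF assms(1,2)] boundary_nodes_iff
      nbrs_boundary[unfolded One_nat_def] hedge_def vedge_def insert_commute)

text \<open>The equation at \<open>(Suc i, j)\<close> contains \<open>u (i, j)\<close> with a
  positive coefficient and otherwise only values with first index \<open>Suc i\<close> or
  \<open>Suc (Suc i)\<close>. Agreement for two consecutive first indices thus forces agreement for
  the next smaller one, the ends of each line being given by \<open>sides\<close>.\<close>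

lemma cauchy_unique:
  assumes \<gamma>: "\<gamma> \<in> conductivities n"
    and u: "solves_dirichlet n f \<gamma> \<phi> u" and v: "solves_dirichlet n f \<gamma> \<psi> v"
    and sides: "\<And>i. 1 \<le> i \<Longrightarrow> i \<le> n \<Longrightarrow> u (i, 0) = v (i, 0) \<and> u (i, Suc n) = v (i, Suc n)"
    and rows: "\<And>j. 1 \<le> j \<Longrightarrow> j \<le> n \<Longrightarrow> u (n, j) = v (n, j) \<and> u (Suc n, j) = v (Suc n, j)"
    and p: "(i, j) \<in> nodes n"
  shows "u (i, j) = v (i, j)"
proof -
  define R where "R i \<longleftrightarrow> (\<forall>j. (i, j) \<in> nodes n \<longrightarrow> u (i, j) = v (i, j))" for i
  \<comment> \<open>The recursion has depth two, so the descending induction carries both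
    lines.\<close>
  have "R i \<and> R (Suc i)" if "i \<le> n" for i
    using that
  proof (induction i rule: inc_induct)
    case base
    have "R n"
      unfolding R_def
    proof (intro allI impI)
      fix j assume "(n, j) \<in> nodes n"
      then show "u (n, j) = v (n, j)"
        using sides[of n] rows[of j] by (cases "j = 0"; cases "j = Suc n") (auto simp: nodes_iff)
    qed
    moreover have "R (Suc n)"
      unfolding R_def using rows by (auto simp: nodes_iff)
    ultimately show ?case by simp
  next
    case (step i)
    have "u (i, j) = v (i, j)" if ij: "(i, j) \<in> nodes n" for j
    proof (cases "j = 0 \<or> j = Suc n")
      case True
      with ij sides[of i] show ?thesis by (auto simp: nodes_iff)
    next
      case False
      with ij obtain j' where j: "j = Suc j'" "Suc j' \<le> n"
        by (cases j) (auto simp: nodes_iff)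
      have i: "Suc i \<le> n" using step.hyps by simp
      have "u (Suc i, l) = v (Suc i, l)" if "l \<le> Suc n" for l
        using step.IH i that by (simp add: R_def nodes_iff)
      moreover have "u (Suc (Suc i), Suc j') = v (Suc (Suc i), Suc j')"
        using step.IH i j by (simp add: R_def nodes_iff)
      moreover from calculation have "star_sum \<gamma> u i j' = star_sum \<gamma> v i j'"
        using i j by (simp add: solves_dirichlet_star[OF u] solves_dirichlet_star[OF v])
      ultimately show ?thesis
        using hedge_pos[OF \<gamma>, of i "Suc j'"] i j by (simp add: star_sum_def)
    qed
    with step.IH show ?case by (simp add: R_def)
  qed
  then have "R i"
    using p by (cases i) (auto simp: nodes_iff)
  with p show ?thesis by (simp add: R_def)
qed

text \<open>
  The solution that vanishes on the layers above \<open>k\<close> and equals \<open>a\<close> on \<open>J1 n k\<close>: the equation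
  at \<open>(i + 1, j + 1)\<close> is solved for the value at \<open>(i, j + 1)\<close>, so that each row is computed
  from the two rows with larger first index.
\<close>

function corner_rec :: "(edge \<Rightarrow> real) \<Rightarrow> nat \<Rightarrow> (node \<Rightarrow> real) \<Rightarrow> nat \<Rightarrow> nat \<Rightarrow> real"
  where
    "corner_rec \<gamma> k a i 0 = (if k < i then 0 else a (i, 0))"
  | "corner_rec \<gamma> k a i (Suc j) = (if k < i + Suc j then 0 else
      corner_rec \<gamma> k a (Suc i) (Suc j) +
      (f (Suc i, Suc j) (corner_rec \<gamma> k a (Suc i) (Suc j))
       - \<gamma> (hedge (Suc i) (Suc j)) *
         (corner_rec \<gamma> k a (Suc (Suc i)) (Suc j) - corner_rec \<gamma> k a (Suc i) (Suc j))
       - \<gamma> (vedge (Suc i) j) *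
         (corner_rec \<gamma> k a (Suc i) j - corner_rec \<gamma> k a (Suc i) (Suc j))
       - \<gamma> (vedge (Suc i) (Suc j)) *
         (corner_rec \<gamma> k a (Suc i) (Suc (Suc j)) - corner_rec \<gamma> k a (Suc i) (Suc j)))
      / \<gamma> (hedge i (Suc j)))"
  by pat_completeness auto
termination
  \<comment> \<open>Every recursive call raises \<open>i\<close>, and calls occur only for
    \<open>i + Suc j \<le> k\<close>, so \<open>Suc k - i\<close> drops.\<close>
  by (relation "Wellfounded.measure (\<lambda>(\<gamma>, k, a, i, j). Suc k - i)") auto

declare corner_rec.simps(2) [simp del]

lemma corner_rec_zero: "k < i + j \<Longrightarrow> corner_rec \<gamma> k a i j = 0"
  by (cases j) (auto simp: corner_rec.simps(2))

definition corner_sol :: "(edge \<Rightarrow> real) \<Rightarrow> nat \<Rightarrow> (node \<Rightarrow> real) \<Rightarrow> node \<Rightarrow> real"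
  where "corner_sol \<gamma> k a = (\<lambda>(i, j)\<in>nodes n. corner_rec \<gamma> k a i j)"

text \<open>Up to the cut-off this is the recursion rearranged. Beyond it,
  \<open>k < i + Suc j\<close>, the centre and all four neighbours lie above layer \<open>k\<close>,
  so both sides vanish by \<open>f_zero\<close>.\<close>

lemma corner_sol_star:
  assumes \<gamma>: "\<gamma> \<in> conductivities n" and ij: "Suc i \<le> n" "Suc j \<le> n"
  shows "star_sum \<gamma> (corner_sol \<gamma> k a) i j = f (Suc i, Suc j) (corner_sol \<gamma> k a (Suc i, Suc j))"
proof -
  have [simp]: "corner_sol \<gamma> k a (i, Suc j) = corner_rec \<gamma> k a i (Suc j)"
    "corner_sol \<gamma> k a (Suc i, Suc j) = corner_rec \<gamma> k a (Suc i) (Suc j)"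
    "corner_sol \<gamma> k a (Suc (Suc i), Suc j) = corner_rec \<gamma> k a (Suc (Suc i)) (Suc j)"
    "corner_sol \<gamma> k a (Suc i, j) = corner_rec \<gamma> k a (Suc i) j"
    "corner_sol \<gamma> k a (Suc i, Suc (Suc j)) = corner_rec \<gamma> k a (Suc i) (Suc (Suc j))"
    using ij by (simp_all add: corner_sol_def nodes_iff)
  have int: "(Suc i, Suc j) \<in> interior_nodes n"
    using ij by (simp add: interior_nodes_iff)
  show ?thesis
  proof (cases "k < i + Suc j")
    case True
    then show ?thesis
      by (simp add: star_sum_def corner_rec_zero f_zero[OF int])
  next
    case False
    have "\<gamma> (hedge i (Suc j)) \<noteq> 0"
      using hedge_pos[OF \<gamma>, of i "Suc j"] ij by simp
    then show ?thesis
      using False by (simp add: star_sum_def corner_rec.simps(2)[of \<gamma> k a i j])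
  qed
qed

lemma corner_sol_solves:
  assumes "\<gamma> \<in> conductivities n" "\<And>p. p \<in> boundary_nodes n \<Longrightarrow> corner_sol \<gamma> k a p = \<phi> p"
  shows "solves_dirichlet n f \<gamma> \<phi> (corner_sol \<gamma> k a)"
  using assms(2) corner_sol_star[OF assms(1)]
  by (intro solves_dirichletI) (auto simp: corner_sol_def)

lemma corner_sol_zero: "(i, j) \<in> nodes n \<Longrightarrow> k < i + j \<Longrightarrow> corner_sol \<gamma> k a (i, j) = 0"
  by (simp add: corner_sol_def corner_rec_zero)

lemma corner_sol_J1: "1 \<le> i \<Longrightarrow> i \<le> k \<Longrightarrow> k \<le> n \<Longrightarrow> corner_sol \<gamma> k a (i, 0) = a (i, 0)"
  by (simp add: corner_sol_def nodes_iff)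

section \<open>Existence and uniqueness of the completed corner datum\<close>

lemma J1_iff: "k \<le> n \<Longrightarrow> (i, j) \<in> J1 n k \<longleftrightarrow> 1 \<le> i \<and> i \<le> k \<and> j = 0"
  by (auto simp: J1_def layers_upto_def boundary_nodes_iff)

lemma J2_iff: "k \<le> n \<Longrightarrow> (i, j) \<in> J2 n k \<longleftrightarrow> 1 \<le> j \<and> j \<le> k \<and> i = 0"
  by (auto simp: J2_def layers_upto_def boundary_nodes_iff)

lemma layers_above_boundary_iff:
  "(i, j) \<in> layers_above (boundary_nodes n) k \<longleftrightarrow> (i, j) \<in> boundary_nodes n \<and> k < i + j"
  by (auto simp: layers_above_def layers_upto_def)

text \<open>Since \<open>k \<le> n\<close>, a boundary node outside \<open>J1 n k\<close> and
  \<open>J2 n k\<close> lies above layer \<open>k\<close>. The values that the recursion produces on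
  \<open>J2 n k\<close> serve as the second part of the datum.\<close>

lemma corner_sol_boundary:
  assumes k: "k \<le> n" and p: "p \<in> boundary_nodes n"
  shows "corner_sol \<gamma> k a p = glue n k a (restrict (corner_sol \<gamma> k a) (J2 n k)) p"
proof -
  obtain i j where ij: "p = (i, j)" by force
  have n: "(i, j) \<in> nodes n" using p by (simp add: nodes_def ij)
  consider "1 \<le> i" "i \<le> k" "j = 0" | "i = 0" "1 \<le> j" "j \<le> k" | "k < i + j"
    using p k unfolding ij boundary_nodes_iff by fastforce
  then show ?thesis
  proof cases
    case 1
    then show ?thesis using p k by (simp add: glue_def ij J1_iff corner_sol_J1)
  next
    case 2
    then show ?thesis using p k by (simp add: glue_def ij J1_iff J2_iff)
  next
    case 3
    then show ?thesis
      using p k n by (auto simp: glue_def ij J1_iff J2_iff corner_sol_zero)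
  qed
qed

text \<open>The inner neighbour of a boundary node above layer \<open>k\<close> is again above layer
  \<open>k\<close>; on the far sides this uses \<open>k \<le> n\<close>. So value and current both
  vanish there.\<close>

lemma glue_corner_sol:
  assumes k: "k \<le> n" and \<gamma>: "\<gamma> \<in> conductivities n"
  shows "glue n k a (restrict (corner_sol \<gamma> k a) (J2 n k)) \<in> corner_space n f \<gamma> k"
    (is "?\<phi> \<in> _")
proof -
  let ?u = "corner_sol \<gamma> k a"
  have u: "solves_dirichlet n f \<gamma> ?\<phi> ?u"
    by (rule corner_sol_solves[OF \<gamma> corner_sol_boundary[OF k]])
  have "?\<phi> (i, j) = 0 \<and> DN_map n f \<gamma> ?\<phi> (i, j) = 0"
    if b: "(i, j) \<in> boundary_nodes n" and l: "k < i + j" for i j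
  proof
    have n: "(i, j) \<in> nodes n" using b by (simp add: nodes_def)
    show "?\<phi> (i, j) = 0"
      using corner_sol_boundary[OF k b] corner_sol_zero[OF n l] by simp
    consider "1 \<le> i" "i \<le> n" "j = 0" | "1 \<le> i" "i \<le> n" "j = Suc n"
      | "1 \<le> j" "j \<le> n" "i = 0" | "1 \<le> j" "j \<le> n" "i = Suc n"
      using b unfolding boundary_nodes_iff by auto
    then show "DN_map n f \<gamma> ?\<phi> (i, j) = 0"
      using l k
      by cases (simp_all add: DN_map_sides[OF \<gamma> u, unfolded One_nat_def] corner_sol_zero nodes_iff)
  qed
  then have "?\<phi> p = 0 \<and> DN_map n f \<gamma> ?\<phi> p = 0" if "p \<in> layers_above (boundary_nodes n) k" for p
    using that by (cases p) (simp only: layers_above_boundary_iff)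
  moreover have "?\<phi> \<in> funs (boundary_nodes n)"
    by (simp add: glue_def)
  ultimately show ?thesis
    unfolding corner_space_def by blast
qed

text \<open>Membership in the corner space fixes Cauchy data: zero value and zero current on the
  side \<open>i = n + 1\<close>, and prescribed values on the sides \<open>j = 0\<close> and
  \<open>j = n + 1\<close>. These are the data of \<open>corner_sol\<close>, so
  \<open>cauchy_unique\<close> identifies the two states.\<close>

lemma corner_space_unique:
  assumes k: "k \<le> n" and n: "1 \<le> n" and \<gamma>: "\<gamma> \<in> conductivities n"
    and b: "b \<in> funs (J2 n k)" "glue n k a b \<in> corner_space n f \<gamma> k"
  shows "b = restrict (corner_sol \<gamma> k a) (J2 n k)"
proof -
  let ?u = "corner_sol \<gamma> k a" and ?\<phi> = "glue n k a b"
  \<comment> \<open>The state serves as its own boundary datum, since the comparison uses only its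
    interior equations and its values.\<close>
  have u: "solves_dirichlet n f \<gamma> ?u ?u"
    by (rule corner_sol_solves[OF \<gamma>]) simp
  obtain v where v: "solves_dirichlet n f \<gamma> ?\<phi> v"
    using dirichlet_exists[OF \<gamma>] by blast
  have vb: "v p = ?\<phi> p" if "p \<in> boundary_nodes n" for p
    using v that by (simp add: solves_dirichlet_def)
  have zero: "v (i, j) = 0" "DN_map n f \<gamma> ?\<phi> (i, j) = 0"
    if "(i, j) \<in> boundary_nodes n" "k < i + j" for i j
    using b(2) that vb by (auto simp: corner_space_def layers_above_boundary_iff)
  have eq: "v (i, j) = ?u (i, j)" if "(i, j) \<in> nodes n" for i j
  proof (rule cauchy_unique[OF \<gamma> v u _ _ that])
    fix i assume i: "1 \<le> i" "i \<le> n"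
    have "v (i, 0) = ?u (i, 0)"
    proof (cases "i \<le> k")
      case True
      then show ?thesis
        using i k by (simp add: vb boundary_nodes_iff glue_def J1_iff corner_sol_J1)
    next
      case False
      then show ?thesis
        using i zero(1)[of i 0] by (simp add: boundary_nodes_iff nodes_iff corner_sol_zero)
    qed
    moreover have "v (i, Suc n) = ?u (i, Suc n)"
      using i k zero(1)[of i "Suc n"] by (simp add: boundary_nodes_iff nodes_iff corner_sol_zero)
    ultimately show "v (i, 0) = ?u (i, 0) \<and> v (i, Suc n) = ?u (i, Suc n)" ..
  next
    fix j assume j: "1 \<le> j" "j \<le> n"
    have v0: "v (Suc n, j) = 0"
      using j k zero(1)[of "Suc n" j] by (simp add: boundary_nodes_iff)
    \<comment> \<open>No current through an edge of positive conductivity means equal end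
      values.\<close>
    moreover have "v (n, j) = 0"
      using zero(2)[of "Suc n" j] hedge_pos[OF \<gamma>, of n j] j k v0
      by (simp add: DN_map_sides(3)[OF \<gamma> v] boundary_nodes_iff)
    ultimately show "v (n, j) = ?u (n, j) \<and> v (Suc n, j) = ?u (Suc n, j)"
      using j k n by (simp add: corner_sol_zero nodes_iff)
  qed
  show ?thesis
  proof (rule extensionalityI)
    show "b \<in> extensional (J2 n k)" using b(1) by (simp add: PiE_def)
    fix p assume "p \<in> J2 n k"
    then obtain j where j: "p = (0, j)" "1 \<le> j" "j \<le> k"
      using k by (cases p) (auto simp: J2_iff)
    then show "b p = restrict ?u (J2 n k) p"
      using eq[of 0 j] vb[of p] k
      by (simp add: nodes_iff glue_def J1_iff J2_iff boundary_nodes_iff)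
  qed simp
qed

lemma phi2_eq:
  assumes "k \<le> n" "1 \<le> n" "\<gamma> \<in> conductivities n"
  shows "phi2 n f \<gamma> k a = restrict (corner_sol \<gamma> k a) (J2 n k)"
  unfolding phi2_def
  using corner_space_unique[OF assms] glue_corner_sol[OF assms(1,3)]
  by (intro the_equality) auto

section \<open>States driven by the unit vectors\<close>

definition corner_state :: "(edge \<Rightarrow> real) \<Rightarrow> nat \<Rightarrow> node \<Rightarrow> real"
  where "corner_state \<gamma> k = corner_sol \<gamma> k (unit_vec n k)"

lemma corner_state_solves:
  assumes "1 \<le> k" "k \<le> n" "\<gamma> \<in> conductivities n"
  shows "solves_dirichlet n f \<gamma> (corner_datum n f \<gamma> k) (corner_state \<gamma> k)"
  unfolding corner_state_def corner_datum_def using assms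
  by (intro corner_sol_solves) (simp_all add: phi2_eq corner_sol_boundary)

lemma corner_state_zero: "(i, j) \<in> nodes n \<Longrightarrow> k < i + j \<Longrightarrow> corner_state \<gamma> k (i, j) = 0"
  by (simp add: corner_state_def corner_sol_zero)

lemma corner_state_one: "1 \<le> k \<Longrightarrow> k \<le> n \<Longrightarrow> corner_state \<gamma> k (k, 0) = 1"
  by (simp add: corner_state_def corner_sol_J1 unit_vec_def J1_iff)

text \<open>At a node of layer \<open>k + 1\<close> only the two neighbours in layer \<open>k\<close> contribute.\<close>

lemma corner_state_balance:
  assumes "1 \<le> k" "k \<le> n" "\<gamma> \<in> conductivities n" "i + Suc j = k"
  shows "\<gamma> (hedge i (Suc j)) * corner_state \<gamma> k (i, Suc j) +
    \<gamma> (vedge (Suc i) j) * corner_state \<gamma> k (Suc i, j) = 0"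
proof -
  have ij: "Suc i \<le> n" "Suc j \<le> n" using assms by auto
  then have "f (Suc i, Suc j) 0 = 0"
    by (intro f_zero) (simp add: interior_nodes_iff)
  moreover have "corner_state \<gamma> k (Suc i, Suc j) = 0" "corner_state \<gamma> k (Suc (Suc i), Suc j) = 0"
    "corner_state \<gamma> k (Suc i, Suc (Suc j)) = 0"
    using assms(4) ij by (auto simp: nodes_iff intro!: corner_state_zero)
  ultimately show ?thesis
    using solves_dirichlet_star[OF corner_state_solves[OF assms(1-3)] ij]
    by (simp add: star_sum_def)
qed

text \<open>The value at \<open>(k, 0)\<close> is \<open>1\<close>, and the balance relation carries
  nonvanishing from each node of layer \<open>k\<close> to the next, all conductivities being
  positive.\<close>

lemma corner_state_nonzero:
  assumes "1 \<le> k" "k \<le> n" "\<gamma> \<in> conductivities n" "i + j = k"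
  shows "corner_state \<gamma> k (i, j) \<noteq> 0"
  using assms(4)
proof (induction j arbitrary: i)
  case 0
  then show ?case using assms by (simp add: corner_state_one)
next
  case (Suc j)
  then have "corner_state \<gamma> k (Suc i, j) \<noteq> 0" by simp
  moreover have "\<gamma> (vedge (Suc i) j) \<noteq> 0"
    using vedge_pos[OF assms(3), of "Suc i" j] Suc.prems assms by simp
  ultimately show ?case
    using corner_state_balance[OF assms(1-3) Suc.prems] by auto
qed

end

subsection \<open>Recovery of the conductivity layer by layer\<close>

text \<open>Isolates one neighbour \<open>w\<close> of a centre \<open>t\<close>; \<open>c\<close>
  is the conductivity between them and \<open>R\<close> collects the remaining terms of the
  equation.\<close>

lemma solve_for_neighbour: "c \<noteq> 0 \<Longrightarrow> R = c * (w - t) \<Longrightarrow> t + R / c = w" for c :: real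
  by simp

locale recovery = network +
  fixes r :: enat and \<gamma>0 :: "edge \<Rightarrow> real"
  assumes f_class: "\<And>p. p \<in> interior_nodes n \<Longrightarrow> C_class_real r (f p)"
    and \<gamma>0: "\<gamma>0 \<in> conductivities n"
begin

text \<open>One map \<open>C\<close> must serve every conductivity whose data lie in
  \<open>U\<close>, not only those close to \<open>\<gamma>0\<close>. The neighbourhood may shrink
  with each operation, so such quantities are closed under arithmetic.\<close>

definition recoverable :: "((edge \<Rightarrow> real) \<Rightarrow> real) \<Rightarrow> bool"
  where "recoverable Q \<longleftrightarrow> (\<exists>U C.
    openin (powertop_real (meas_index n)) U \<and> M_minus n f \<gamma>0 \<in> U \<and>
    C_class_on r (meas_index n) U C \<and>
    (\<forall>\<gamma>\<in>conductivities n. M_minus n f \<gamma> \<in> U \<longrightarrow> C (M_minus n f \<gamma>) = Q \<gamma>))"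

lemma recoverable_cong:
  "recoverable Q \<Longrightarrow> (\<And>\<gamma>. \<gamma> \<in> conductivities n \<Longrightarrow> Q \<gamma> = Q' \<gamma>) \<Longrightarrow> recoverable Q'"
  unfolding recoverable_def by (elim exE conjE, intro exI conjI) auto

lemma M_minus_in_funs: "M_minus n f \<gamma> \<in> funs (meas_index n)"
  by (simp add: M_minus_def)

lemma recoverableI:
  assumes "C_class_on r (meas_index n) (funs (meas_index n)) C"
    and "\<And>\<gamma>. \<gamma> \<in> conductivities n \<Longrightarrow> C (M_minus n f \<gamma>) = Q \<gamma>"
  shows "recoverable Q"
  unfolding recoverable_def
  using assms M_minus_in_funs open_funs
  by (intro exI[of _ "funs (meas_index n)"] exI[of _ C]) simp

lemma recoverable_const: "recoverable (\<lambda>\<gamma>. c)"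
  by (rule recoverableI[OF C_class_on_const[OF open_funs]]) simp

lemma recoverable_M_minus: "i \<in> meas_index n \<Longrightarrow> recoverable (\<lambda>\<gamma>. M_minus n f \<gamma> i)"
  by (rule recoverableI[OF C_class_on_proj[OF open_funs]]) simp_all

lemma recoverable_binop:
  assumes closed: "\<And>U G H. openin (powertop_real (meas_index n)) U \<Longrightarrow>
      C_class_on r (meas_index n) U G \<Longrightarrow> C_class_on r (meas_index n) U H \<Longrightarrow>
      C_class_on r (meas_index n) U (\<lambda>x. b (G x) (H x))"
    and "recoverable P" "recoverable Q"
  shows "recoverable (\<lambda>\<gamma>. b (P \<gamma>) (Q \<gamma>))"
proof -
  obtain U G where U: "openin (powertop_real (meas_index n)) U" "M_minus n f \<gamma>0 \<in> U"
    "C_class_on r (meas_index n) U G"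
    "\<And>\<gamma>. \<gamma> \<in> conductivities n \<Longrightarrow> M_minus n f \<gamma> \<in> U \<Longrightarrow> G (M_minus n f \<gamma>) = P \<gamma>"
    using assms(2) unfolding recoverable_def by blast
  obtain V H where V: "openin (powertop_real (meas_index n)) V" "M_minus n f \<gamma>0 \<in> V"
    "C_class_on r (meas_index n) V H"
    "\<And>\<gamma>. \<gamma> \<in> conductivities n \<Longrightarrow> M_minus n f \<gamma> \<in> V \<Longrightarrow> H (M_minus n f \<gamma>) = Q \<gamma>"
    using assms(3) unfolding recoverable_def by blast
  have o: "openin (powertop_real (meas_index n)) (U \<inter> V)"
    using U(1) V(1) by (rule openin_Int)
  have "C_class_on r (meas_index n) (U \<inter> V) (\<lambda>x. b (G x) (H x))"
    by (intro closed o C_class_on_subset[OF U(3)] C_class_on_subset[OF V(3)]) auto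
  with o U V show ?thesis
    unfolding recoverable_def
    by (intro exI[of _ "U \<inter> V"] exI[of _ "\<lambda>x. b (G x) (H x)"]) simp
qed

lemma recoverable_add: "recoverable P \<Longrightarrow> recoverable Q \<Longrightarrow> recoverable (\<lambda>\<gamma>. P \<gamma> + Q \<gamma>)"
  by (rule recoverable_binop[OF C_class_on_add])

lemma recoverable_mult: "recoverable P \<Longrightarrow> recoverable Q \<Longrightarrow> recoverable (\<lambda>\<gamma>. P \<gamma> * Q \<gamma>)"
  by (rule recoverable_binop[OF C_class_on_mult])

lemma recoverable_minus: "recoverable Q \<Longrightarrow> recoverable (\<lambda>\<gamma>. - Q \<gamma>)"
  using recoverable_mult[OF recoverable_const[of "-1"]] by simp

lemma recoverable_diff: "recoverable P \<Longrightarrow> recoverable Q \<Longrightarrow> recoverable (\<lambda>\<gamma>. P \<gamma> - Q \<gamma>)"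
  using recoverable_add[OF _ recoverable_minus, of P Q] by simp

lemma recoverable_f:
  assumes "p \<in> interior_nodes n" "recoverable Q"
  shows "recoverable (\<lambda>\<gamma>. f p (Q \<gamma>))"
  \<comment> \<open>The unary map \<open>f p\<close> is treated as a binary operation that ignores
    its second argument.\<close>
  using recoverable_binop[of "\<lambda>x y. f p x", OF _ assms(2,2)]
  by (simp add: C_class_on_compose f_class[OF assms(1)])

text \<open>Nonvanishing at the data of \<open>\<gamma>0\<close> spreads to the open set
  \<open>V\<close> by continuity of \<open>C\<close>, and there the inverse keeps its class.\<close>

lemma recoverable_inverse:
  assumes "recoverable Q" "Q \<gamma>0 \<noteq> 0"
  shows "recoverable (\<lambda>\<gamma>. inverse (Q \<gamma>))"
proof -
  obtain U C where U: "openin (powertop_real (meas_index n)) U" "M_minus n f \<gamma>0 \<in> U"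
    "C_class_on r (meas_index n) U C"
    "\<And>\<gamma>. \<gamma> \<in> conductivities n \<Longrightarrow> M_minus n f \<gamma> \<in> U \<Longrightarrow> C (M_minus n f \<gamma>) = Q \<gamma>"
    using assms(1) unfolding recoverable_def by blast
  define V where "V = {x \<in> U. C x \<noteq> 0}"
  have "openin (subtopology (powertop_real (meas_index n)) U)
      {x \<in> topspace (subtopology (powertop_real (meas_index n)) U). C x \<in> - {0}}"
    using C_class_on_continuous[OF U(3)]
    by (rule openin_continuous_map_preimage) auto
  moreover have "{x \<in> topspace (subtopology (powertop_real (meas_index n)) U). C x \<in> - {0}} = V"
    using openin_subset[OF U(1)] by (auto simp: V_def)
  ultimately have "openin (subtopology (powertop_real (meas_index n)) U) V"
    by (simp only:)
  then have V: "openin (powertop_real (meas_index n)) V"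
    using openin_trans_full U(1) by blast
  have "C_class_on r (meas_index n) V (\<lambda>x. inverse (C x))"
    by (intro C_class_on_inverse V C_class_on_subset[OF U(3)]) (auto simp: V_def)
  moreover have "M_minus n f \<gamma>0 \<in> V"
    using U(2,4) \<gamma>0 assms(2) by (simp add: V_def)
  ultimately show ?thesis
    unfolding recoverable_def using V U(4)
    by (intro exI[of _ V] exI[of _ "\<lambda>x. inverse (C x)"]) (simp add: V_def)
qed

lemma recoverable_divide:
  "recoverable P \<Longrightarrow> recoverable Q \<Longrightarrow> Q \<gamma>0 \<noteq> 0 \<Longrightarrow> recoverable (\<lambda>\<gamma>. P \<gamma> / Q \<gamma>)"
  unfolding divide_inverse by (intro recoverable_mult recoverable_inverse)

lemmas recoverable_intros =
  recoverable_const recoverable_add recoverable_diff recoverable_minus recoverable_mult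
  recoverable_divide recoverable_f

lemma recoverable_DN:
  assumes "1 \<le> k" "k \<le> n" "p \<in> boundary_nodes n"
  shows "recoverable (\<lambda>\<gamma>. DN_map n f \<gamma> (corner_datum n f \<gamma> k) p)"
proof -
  have "(k, Inr p) \<in> meas_index n"
    using assms by (simp add: meas_index_def InlI InrI)
  from recoverable_M_minus[OF this] this show ?thesis
    by (simp add: M_minus_def)
qed

lemma recoverable_state_boundary:
  assumes k: "1 \<le> k" "k \<le> n" and p: "p \<in> boundary_nodes n"
  shows "recoverable (\<lambda>\<gamma>. corner_state \<gamma> k p)"
proof (rule recoverable_cong)
  have i: "(k, Inl p) \<in> meas_index n"
    using assms by (simp add: meas_index_def InlI InrI)
  show "recoverable (\<lambda>\<gamma>. M_minus n f \<gamma> (k, Inl p))"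
    using i by (rule recoverable_M_minus)
  show "M_minus n f \<gamma> (k, Inl p) = corner_state \<gamma> k p" if "\<gamma> \<in> conductivities n" for \<gamma>
    using corner_state_solves[OF k that] p i by (simp add: solves_dirichlet_def M_minus_def)
qed

section \<open>Marching inwards and recovering one layer of edges at a time\<close>

text \<open>An edge counts by the layer of its lower endpoint, so this concerns all edges among the
  layers up to \<open>l\<close>. The bounds \<open>1 \<le> j\<close> and \<open>1 \<le> i\<close>
  exclude pairs along the sides, which are not edges.\<close>

definition known_below :: "nat \<Rightarrow> bool"
  where "known_below l \<longleftrightarrow>
    (\<forall>i j. 1 \<le> j \<longrightarrow> i + j < l \<longrightarrow> recoverable (\<lambda>\<gamma>. \<gamma> (hedge i j))) \<and>
    (\<forall>i j. 1 \<le> i \<longrightarrow> i + j < l \<longrightarrow> recoverable (\<lambda>\<gamma>. \<gamma> (vedge i j)))"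

text \<open>On the boundary the state is measured. The measured current through
  \<open>vedge i 0\<close> gives the value at \<open>(i, 1)\<close>, and for larger \<open>j\<close>
  the equation at \<open>(i, j - 1)\<close> is solved for the value at \<open>(i, j)\<close>. The
  other values needed have second index \<open>j - 1\<close> or \<open>j - 2\<close>, hence the
  strong induction.\<close>

lemma recoverable_state:
  assumes k: "1 \<le> k" "k \<le> n" and known: "known_below k"
  shows "i + j \<le> k \<Longrightarrow> (i, j) \<in> nodes n \<Longrightarrow> recoverable (\<lambda>\<gamma>. corner_state \<gamma> k (i, j))"
proof (induction j arbitrary: i rule: less_induct)
  case (less j)
  have h: "recoverable (\<lambda>\<gamma>. \<gamma> (hedge a b))" if "1 \<le> b" "a + b < k" for a b
    using known that by (simp add: known_below_def)
  have v: "recoverable (\<lambda>\<gamma>. \<gamma> (vedge a b))" if "1 \<le> a" "a + b < k" for a b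
    using known that by (simp add: known_below_def)
  show ?case
  proof (cases "(i, j) \<in> boundary_nodes n")
    case True
    then show ?thesis by (rule recoverable_state_boundary[OF k])
  next
    case False
    with less.prems obtain i' j' where ij: "i = Suc i'" "j = Suc j'"
      by (cases i; cases j) (auto simp: nodes_iff boundary_nodes_iff)
    show ?thesis
    proof (cases j')
      case 0
      have "1 \<le> i" "i \<le> n" using less.prems ij k by auto
      then have b: "(i, 0) \<in> boundary_nodes n"
        by (simp add: boundary_nodes_iff)
      have pos: "\<gamma> (vedge i 0) > 0" if "\<gamma> \<in> conductivities n" for \<gamma>
        using vedge_pos[OF that \<open>1 \<le> i\<close> \<open>i \<le> n\<close>] by simp
      show ?thesis
      proof (rule recoverable_cong)
        show "recoverable (\<lambda>\<gamma>. corner_state \<gamma> k (i, 0) -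
            DN_map n f \<gamma> (corner_datum n f \<gamma> k) (i, 0) / \<gamma> (vedge i 0))"
          using pos[OF \<gamma>0] less.prems ij 0
          by (intro recoverable_intros recoverable_state_boundary recoverable_DN k b v) auto
        show "corner_state \<gamma> k (i, 0) - DN_map n f \<gamma> (corner_datum n f \<gamma> k) (i, 0) / \<gamma> (vedge i 0) =
            corner_state \<gamma> k (i, j)" if "\<gamma> \<in> conductivities n" for \<gamma>
          using pos[OF that] ij 0
            DN_map_sides(1)[OF that corner_state_solves[OF k that] \<open>1 \<le> i\<close> \<open>i \<le> n\<close>]
          by simp
      qed
    next
      case (Suc l)
      let ?u = "corner_state"
      let ?e = "\<lambda>\<gamma>. ?u \<gamma> k (Suc i', Suc l) +
        (f (Suc i', Suc l) (?u \<gamma> k (Suc i', Suc l))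
        - \<gamma> (hedge i' (Suc l)) * (?u \<gamma> k (i', Suc l) - ?u \<gamma> k (Suc i', Suc l))
        - \<gamma> (hedge (Suc i') (Suc l)) * (?u \<gamma> k (Suc (Suc i'), Suc l) - ?u \<gamma> k (Suc i', Suc l))
        - \<gamma> (vedge (Suc i') l) * (?u \<gamma> k (Suc i', l) - ?u \<gamma> k (Suc i', Suc l)))
        / \<gamma> (vedge (Suc i') (Suc l))"
      \<comment> \<open>The third bound says that \<open>(i, j)\<close> is at most in layer
        \<open>k\<close>. All edges in \<open>?e\<close> then have their lower endpoint below layer
        \<open>k\<close>, and all nodes in it are at most in layer \<open>k\<close>.\<close>
      have b: "Suc i' \<le> n" "Suc l \<le> n" "i' + l + 3 \<le> k"
        using less.prems ij Suc k by auto
      have pos: "\<gamma> (vedge (Suc i') (Suc l)) > 0" if "\<gamma> \<in> conductivities n" for \<gamma>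
        using vedge_pos[OF that, of "Suc i'" "Suc l"] b by simp
      show ?thesis
      proof (rule recoverable_cong)
        show "recoverable ?e"
          using pos[OF \<gamma>0] b k ij Suc
          by (intro recoverable_intros h v less.IH)
            (simp_all add: nodes_iff interior_nodes_iff)
        show "?e \<gamma> = ?u \<gamma> k (i, j)" if "\<gamma> \<in> conductivities n" for \<gamma>
          unfolding ij Suc
        proof (rule solve_for_neighbour)
          show "\<gamma> (vedge (Suc i') (Suc l)) \<noteq> 0" using pos[OF that] by simp
        qed (use solves_dirichlet_star[OF corner_state_solves[OF k that] b(1,2)]
            in \<open>simp add: star_sum_def\<close>)
      qed
    qed
  qed
qed

text \<open>
  The edges between layers \<open>k\<close> and \<open>k + 1\<close> form a path from \<open>(k, 0)\<close> to \<open>(0, k)\<close>. The measured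
  current at \<open>(k, 0)\<close> gives the first edge; after that the equations at the nodes along the path
  determine one edge after the other.
\<close>

lemma recoverable_layer:
  assumes k: "1 \<le> k" "k \<le> n" and known: "known_below k"
  shows "i + j = k \<Longrightarrow> (1 \<le> i \<longrightarrow> recoverable (\<lambda>\<gamma>. \<gamma> (vedge i j))) \<and>
    (1 \<le> j \<longrightarrow> recoverable (\<lambda>\<gamma>. \<gamma> (hedge i j)))"
proof (induction j arbitrary: i)
  case 0
  then have i: "i = k" by simp
  have "recoverable (\<lambda>\<gamma>. \<gamma> (vedge k 0))"
  proof (rule recoverable_cong)
    show "recoverable (\<lambda>\<gamma>. DN_map n f \<gamma> (corner_datum n f \<gamma> k) (k, 0))"
      using k by (intro recoverable_DN) (simp_all add: boundary_nodes_iff)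
    \<comment> \<open>The state is \<open>1\<close> at \<open>(k, 0)\<close> and \<open>0\<close> at
      \<open>(k, 1)\<close>, so the current is the conductivity itself.\<close>
    show "DN_map n f \<gamma> (corner_datum n f \<gamma> k) (k, 0) = \<gamma> (vedge k 0)"
      if "\<gamma> \<in> conductivities n" for \<gamma>
      using DN_map_sides(1)[OF that corner_state_solves[OF k that] k] k
      by (simp add: corner_state_one corner_state_zero nodes_iff)
  qed
  with i show ?case by simp
next
  case (Suc j)
  note u = recoverable_state[OF k known]
  have nz: "corner_state \<gamma> k (i, Suc j) \<noteq> 0" if "\<gamma> \<in> conductivities n" for \<gamma>
    using corner_state_nonzero[OF k that Suc.prems] .
  have v: "recoverable (\<lambda>\<gamma>. \<gamma> (vedge (Suc i) j))"
    using Suc by simp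
  \<comment> \<open>The balance at \<open>(Suc i, Suc j)\<close> in layer \<open>k + 1\<close>
    passes from the incoming vertical edge to the horizontal one.\<close>
  have h: "recoverable (\<lambda>\<gamma>. \<gamma> (hedge i (Suc j)))"
  proof (rule recoverable_cong)
    show "recoverable (\<lambda>\<gamma>. - (\<gamma> (vedge (Suc i) j) * corner_state \<gamma> k (Suc i, j)) /
        corner_state \<gamma> k (i, Suc j))"
      using nz[OF \<gamma>0] Suc.prems k by (intro recoverable_intros v u) (simp_all add: nodes_iff)
    show "- (\<gamma> (vedge (Suc i) j) * corner_state \<gamma> k (Suc i, j)) / corner_state \<gamma> k (i, Suc j) =
        \<gamma> (hedge i (Suc j))" if "\<gamma> \<in> conductivities n" for \<gamma>
      using corner_state_balance[OF k that Suc.prems]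
      unfolding nonzero_divide_eq_eq[OF nz[OF that]] by linarith
  qed
  have "recoverable (\<lambda>\<gamma>. \<gamma> (vedge i (Suc j)))" if i1: "1 \<le> i"
  proof -
    obtain i' where i: "i = Suc i'" using i1 by (cases i) auto
    let ?u = "corner_state"
    \<comment> \<open>The equation at \<open>(i, Suc j)\<close> in layer \<open>k\<close> is solved
      for the last unknown edge. Both outer neighbours vanish, so that edge is multiplied only by
      the nonzero value at the centre.\<close>
    let ?e = "\<lambda>\<gamma>. (\<gamma> (hedge i' (Suc j)) * (?u \<gamma> k (i', Suc j) - ?u \<gamma> k (Suc i', Suc j))
      - \<gamma> (hedge (Suc i') (Suc j)) * ?u \<gamma> k (Suc i', Suc j)
      + \<gamma> (vedge (Suc i') j) * (?u \<gamma> k (Suc i', j) - ?u \<gamma> k (Suc i', Suc j))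
      - f (Suc i', Suc j) (?u \<gamma> k (Suc i', Suc j))) / ?u \<gamma> k (Suc i', Suc j)"
    have b: "Suc i' \<le> n" "Suc j \<le> n" "i' + j + 2 = k"
      using Suc.prems i k by auto
    have h': "recoverable (\<lambda>\<gamma>. \<gamma> (hedge i' (Suc j)))" "recoverable (\<lambda>\<gamma>. \<gamma> (vedge (Suc i') j))"
      using known b by (simp_all add: known_below_def)
    show ?thesis
    proof (rule recoverable_cong)
      show "recoverable ?e"
        using nz[OF \<gamma>0] b k i
        by (intro recoverable_intros h[unfolded i] h' u) (simp_all add: nodes_iff interior_nodes_iff)
      show "?e \<gamma> = \<gamma> (vedge i (Suc j))" if "\<gamma> \<in> conductivities n" for \<gamma>
      proof -
        have "?u \<gamma> k (Suc (Suc i'), Suc j) = 0" "?u \<gamma> k (Suc i', Suc (Suc j)) = 0"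
          using b by (auto simp: nodes_iff intro!: corner_state_zero)
        with solves_dirichlet_star[OF corner_state_solves[OF k that] b(1,2)]
        show ?thesis
          unfolding i nonzero_divide_eq_eq[OF nz[OF that, unfolded i]] star_sum_def
          by (simp add: algebra_simps)
      qed
    qed
  qed
  with h show ?case by simp
qed

text \<open>The step from \<open>l\<close> to \<open>Suc l\<close> adds the edges whose lower
  endpoint is in layer \<open>l\<close>, by \<open>recoverable_layer\<close> with
  \<open>k = l\<close>. The state for that layer exists for \<open>l \<le> n\<close>, whence the
  bound.\<close>

lemma known_below_corner: "l \<le> Suc n \<Longrightarrow> known_below l"
proof (induction l)
  case 0
  then show ?case by (simp add: known_below_def)
next
  case (Suc l)
  then have IH: "known_below l" by simp
  show ?case
    unfolding known_below_def
  proof (intro conjI allI impI)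
    fix i j :: nat
    assume "1 \<le> j" "i + j < Suc l"
    then show "recoverable (\<lambda>\<gamma>. \<gamma> (hedge i j))"
      using IH recoverable_layer[OF _ _ IH, of i j] Suc.prems
      by (cases "i + j = l") (auto simp: known_below_def)
  next
    fix i j :: nat
    assume "1 \<le> i" "i + j < Suc l"
    then show "recoverable (\<lambda>\<gamma>. \<gamma> (vedge i j))"
      using IH recoverable_layer[OF _ _ IH, of i j] Suc.prems
      by (cases "i + j = l") (auto simp: known_below_def)
  qed
qed

section \<open>Assembling the conductivity of the corner\<close>

text \<open>With both endpoints in layers up to \<open>n + 1\<close>, the lower endpoint is in layer
  at most \<open>n\<close>, which is the range of \<open>known_below (Suc n)\<close>.\<close>

lemma corner_edgesE:
  assumes "e \<in> corner_edges n"
  obtains (h) i j where "e = hedge i j" "1 \<le> j" "i + j \<le> n"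
    | (v) i j where "e = vedge i j" "1 \<le> i" "i + j \<le> n"
proof -
  from assms have "e \<in> edges n" and layers: "e \<subseteq> layers_upto (nodes n) (n + 1)"
    by (auto simp: corner_edges_def edges_within_def)
  then obtain i j a b where e: "e = {(i, j), (a, b)}" and int: "(i, j) \<in> interior_nodes n"
    and adj: "\<bar>int i - int a\<bar> + \<bar>int j - int b\<bar> = 1"
    by (auto simp: edges_def)
  have "adjacent (i, j) (a, b)"
    using adj by (simp add: adjacent_def)
  then consider "a = i" "b = Suc j" | "a = i" "j = Suc b" | "b = j" "a = Suc i" | "b = j" "i = Suc a"
    unfolding adjacent_iff by blast
  moreover have ij: "1 \<le> i" "1 \<le> j" "i + j \<le> n + 1" "a + b \<le> n + 1"
    using int layers by (simp_all add: e interior_nodes_iff layers_upto_def)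
  ultimately show thesis
  proof cases
    case 1
    with ij show ?thesis by (intro v[of i j]) (simp_all add: e vedge_def)
  next
    case 2
    with ij show ?thesis by (intro v[of i b]) (simp_all add: e vedge_def insert_commute)
  next
    case 3
    with ij show ?thesis by (intro h[of i j]) (simp_all add: e hedge_def)
  next
    case 4
    with ij show ?thesis by (intro h[of a j]) (simp_all add: e hedge_def insert_commute)
  qed
qed

lemma recoverable_corner_edge:
  assumes "e \<in> corner_edges n"
  shows "recoverable (\<lambda>\<gamma>. \<gamma> e)"
  using assms
proof (cases rule: corner_edgesE)
  case (h i j)
  with known_below_corner[of "Suc n"] show ?thesis by (simp add: known_below_def)
next
  case (v i j)
  with known_below_corner[of "Suc n"] show ?thesis by (simp add: known_below_def)
qed

text \<open>There are finitely many corner edges, so the neighbourhoods found for the single edges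
  can be intersected and the local inverses combined componentwise.\<close>

lemma local_recovery:
  "\<exists>U C. openin (powertop_real (meas_index n)) U \<and> M_minus n f \<gamma>0 \<in> U \<and>
    C \<in> U \<rightarrow> funs (corner_edges n) \<and>
    (\<forall>e\<in>corner_edges n. C_class_on r (meas_index n) U (\<lambda>x. C x e)) \<and>
    (\<forall>\<gamma>\<in>conductivities n. M_minus n f \<gamma> \<in> U \<longrightarrow>
      C (M_minus n f \<gamma>) = restrict \<gamma> (corner_edges n))"
proof -
  define good where "good e U C \<longleftrightarrow> openin (powertop_real (meas_index n)) U \<and> M_minus n f \<gamma>0 \<in> U \<and>
    C_class_on r (meas_index n) U C \<and>
    (\<forall>\<gamma>\<in>conductivities n. M_minus n f \<gamma> \<in> U \<longrightarrow> C (M_minus n f \<gamma>) = \<gamma> e)" for e U C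
  have "\<forall>e\<in>corner_edges n. \<exists>U C. good e U C"
    using recoverable_corner_edge by (simp add: recoverable_def good_def)
  then obtain U C where "\<forall>e\<in>corner_edges n. good e (U e) (C e)"
    by metis
  then have U: "openin (powertop_real (meas_index n)) (U e)" "M_minus n f \<gamma>0 \<in> U e"
    and C: "C_class_on r (meas_index n) (U e) (C e)"
    and inv: "\<And>\<gamma>. \<gamma> \<in> conductivities n \<Longrightarrow> M_minus n f \<gamma> \<in> U e \<Longrightarrow> C e (M_minus n f \<gamma>) = \<gamma> e"
    if "e \<in> corner_edges n" for e
    using that unfolding good_def by blast+
  \<comment> \<open>The factor \<open>topspace\<close> keeps \<open>V\<close> open even when the
    index set is empty and the intersection is the whole type.\<close>
  define V where "V = (\<Inter>e\<in>corner_edges n. U e) \<inter> topspace (powertop_real (meas_index n))"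
  have sub: "V \<subseteq> U e" if "e \<in> corner_edges n" for e
    using that unfolding V_def by blast
  have "finite (corner_edges n)"
    by (simp add: corner_edges_def edges_within_def)
  then have "openin (powertop_real (meas_index n)) V"
    unfolding V_def using U(1) by (rule openin_INT)
  moreover have "M_minus n f \<gamma>0 \<in> V"
    unfolding V_def topspace_product_topology topspace_euclidean
    using U(2) M_minus_in_funs by blast
  moreover have "C_class_on r (meas_index n) V (\<lambda>x. (\<lambda>e\<in>corner_edges n. C e x) e)"
    if e: "e \<in> corner_edges n" for e
    using C_class_on_subset[OF C[OF e] sub[OF e]] e by simp
  moreover have "(\<lambda>e\<in>corner_edges n. C e (M_minus n f \<gamma>)) = restrict \<gamma> (corner_edges n)"
    if "\<gamma> \<in> conductivities n" "M_minus n f \<gamma> \<in> V" for \<gamma>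
    using inv that sub by (intro restrict_ext) blast
  moreover have "(\<lambda>x. \<lambda>e\<in>corner_edges n. C e x) \<in> V \<rightarrow> funs (corner_edges n)"
    by (rule Pi_I) simp
  ultimately show ?thesis
    by (intro exI[of _ V] exI[of _ "\<lambda>x. \<lambda>e\<in>corner_edges n. C e x"] conjI ballI impI)
qed

end

theorem theorem4p2:
  fixes n :: nat and f :: "node \<Rightarrow> real \<Rightarrow> real"
  assumes "n \<ge> 1"
    and "\<And>p. p \<in> interior_nodes n \<Longrightarrow> continuous_on UNIV (f p)"
    and "\<And>p. p \<in> interior_nodes n \<Longrightarrow> mono (f p)"
    and "\<And>p. p \<in> interior_nodes n \<Longrightarrow> f p 0 = 0"
  shows "(\<forall>\<gamma>\<in>conductivities n. \<forall>\<gamma>'\<in>conductivities n.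
            M_minus n f \<gamma> = M_minus n f \<gamma>' \<longrightarrow> restrict \<gamma> (corner_edges n) = restrict \<gamma>' (corner_edges n))
       \<and> (\<forall>r :: enat. (\<forall>p\<in>interior_nodes n. C_class_real r (f p)) \<longrightarrow>
            (\<forall>\<gamma>0\<in>conductivities n. \<exists>U C.
               openin (powertop_real (meas_index n)) U \<and> M_minus n f \<gamma>0 \<in> U \<and>
               C \<in> U \<rightarrow> funs (corner_edges n) \<and>
               (\<forall>e\<in>corner_edges n. C_class_on r (meas_index n) U (\<lambda>x. C x e)) \<and>
               (\<forall>\<gamma>\<in>conductivities n. M_minus n f \<gamma> \<in> U \<longrightarrow>
                  C (M_minus n f \<gamma>) = restrict \<gamma> (corner_edges n))))"
proof (intro conjI ballI allI impI)
  interpret network n f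
    by unfold_locales (use assms in auto)
  fix r \<gamma>0
  assume "\<forall>p\<in>interior_nodes n. C_class_real r (f p)" "\<gamma>0 \<in> conductivities n"
  then interpret recovery n f r \<gamma>0
    by unfold_locales auto
  show "\<exists>U C. openin (powertop_real (meas_index n)) U \<and> M_minus n f \<gamma>0 \<in> U \<and>
      C \<in> U \<rightarrow> funs (corner_edges n) \<and>
      (\<forall>e\<in>corner_edges n. C_class_on r (meas_index n) U (\<lambda>x. C x e)) \<and>
      (\<forall>\<gamma>\<in>conductivities n. M_minus n f \<gamma> \<in> U \<longrightarrow>
        C (M_minus n f \<gamma>) = restrict \<gamma> (corner_edges n))"
    by (rule local_recovery)
next
  interpret network n f
    by unfold_locales (use assms in auto)
  fix \<gamma> \<gamma>'
  assume \<gamma>: "\<gamma> \<in> conductivities n" and \<gamma>': "\<gamma>' \<in> conductivities n"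
    and eq: "M_minus n f \<gamma> = M_minus n f \<gamma>'"
  \<comment> \<open>Class C^0 is continuity. The equal data of \<open>\<gamma>\<close> and
    \<open>\<gamma>'\<close> lie in the same \<open>U\<close>, where a single map \<open>C\<close>
    yields both restrictions.\<close>
  interpret recovery n f 0 \<gamma>
    by unfold_locales (use \<gamma> f_cont in \<open>auto simp: C_class_real_def zero_enat_def\<close>)
  obtain U C where "M_minus n f \<gamma> \<in> U" and "\<And>\<gamma>. \<gamma> \<in> conductivities n \<Longrightarrow> M_minus n f \<gamma> \<in> U \<Longrightarrow>
      C (M_minus n f \<gamma>) = restrict \<gamma> (corner_edges n)"
    using local_recovery by blast
  from this(1) this(2)[OF \<gamma>] this(2)[OF \<gamma>']
  show "restrict \<gamma> (corner_edges n) = restrict \<gamma>' (corner_edges n)"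
    unfolding eq by simp
qed

end
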